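(* Let $(\theta,q)\in(0,1)\times(2,\infty]$ and $\alpha:=\frac{1-\theta}{2}$. Then there exists $f\in(C_b^0(\mathbb{R}),{\rm Lip}^0(\mathbb{R}))_{\theta,q}$ such that, with $F(t,x):=\mathbb{E}f(x+W_{1-t})$, $\varphi_t:=\frac{\partial F}{\partial x}(t,W_t)$ for $t\in[0,1)$ and $\mathcal I^\alpha_t\varphi:=\alpha\int_0^1(1-u)^{\alpha-1}\varphi_{u\wedge t}\,\mathrm{d}u$ for $t\in[0,1)$, one has \[ \mathcal I^\alpha\varphi-\varphi_0\notin\mathrm{BMO}_2([0,1)). \]
   Context: $(\Omega,\mathcal F,\mathbb P,(\mathcal F_t)_{t\in[0,1]})$ is a complete probability space with the augmented natural filtration of a standard one-dimensional Brownian motion $(W_t)_{t\in[0,1]}$ with $W_0\equiv0$ and continuous paths, $\mathcal F=\mathcal F_1$. $C_b^0(\mathbb{R})$ is the Banach space of bounded continuous $f:\mathbb{R}\to\mathbb{R}$ with $f(0)=0$ with the sup-norm; ${\rm Lip}^0(\mathbb{R})$ the space of Lipschitz $f$ with $f(0)=0$ normed by the Lipschitz constant. For Banach spaces $(E_0,E_1)$, $(E_0,E_1)_{\theta,q}$ is the real interpolation space of all $x\in E_0+E_1$ with $\|\lambda\mapsto\lambda^{-\theta}K(\lambda,x;E_0,E_1)\|_{L_q((0,\infty),\mathrm{d}\lambda/\lambda)}<\infty$, where $K(\lambda,x;E_0,E_1):=\inf\{\|x_0\|_{E_0}+\lambda\|x_1\|_{E_1}:x=x_0+x_1\}$. For an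 adapted càdlàg process $Y=(Y_t)_{t\in[0,1)}$ with $Y_t\in L_2$, $\|Y\|_{\mathrm{BMO}_2([0,1))}:=\sup_{a\in[0,1)}\big\|\big(\mathbb{E}[\sup_{a\le t<1}|Y_t-Y_{a-}|^2\mid\mathcal F_a]\big)^{1/2}\big\|_{L_\infty}$ with $Y_{0-}:=Y_0$, and $\mathrm{BMO}_2([0,1))$ is the space of such $Y$ with finite norm. *)

theory Defs
  imports "HOL-Probability.Probability"
begin

definition Cb0 :: "(real \<Rightarrow> real) set" where
  "Cb0 = {f. continuous_on UNIV f \<and> bounded (range f) \<and> f 0 = 0}"

definition sup_norm :: "(real \<Rightarrow> real) \<Rightarrow> real" where
  "sup_norm f = (SUP x. \<bar>f x\<bar>)"

definition Lip0 :: "(real \<Rightarrow> real) set" where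
  "Lip0 = {f. (\<exists>L. lipschitz_on L UNIV f) \<and> f 0 = 0}"

definition lip_norm :: "(real \<Rightarrow> real) \<Rightarrow> real" where
  "lip_norm f = (SUP p \<in> {p :: real \<times> real. fst p \<noteq> snd p}.
                    \<bar>f (fst p) - f (snd p)\<bar> / \<bar>fst p - snd p\<bar>)"

definition K_fun :: "real \<Rightarrow> (real \<Rightarrow> real) \<Rightarrow> real" where
  "K_fun lam f = Inf {sup_norm f0 + lam * lip_norm f1 | f0 f1.
                        f0 \<in> Cb0 \<and> f1 \<in> Lip0 \<and> f = (\<lambda>x. f0 x + f1 x)}"

definition interp_space :: "real \<Rightarrow> ereal \<Rightarrow> (real \<Rightarrow> real) set" where
  "interp_space \<theta> q = {f. (\<exists>f0 f1. f0 \<in> Cb0 \<and> f1 \<in> Lip0 \<and> f = (\<lambda>x. f0 x + f1 x)) \<and>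
      (if q = \<infinity> then bdd_above ((\<lambda>lam. lam powr (-\<theta>) * K_fun lam f) ` {0<..})
       else (\<integral>\<^sup>+ lam \<in> {0<..}. ennreal ((lam powr (-\<theta>) * K_fun lam f) powr (real_of_ereal q) / lam) \<partial>lborel) < \<infinity>)}"

definition aug_filtration :: "'a measure \<Rightarrow> (real \<Rightarrow> 'a \<Rightarrow> real) \<Rightarrow> real \<Rightarrow> 'a measure" where
  "aug_filtration M W t = sigma (space M)
     ({W s -` B \<inter> space M | s B. s \<in> {0..t} \<and> B \<in> sets borel} \<union> null_sets M)"

definition brownian_setting :: "'a measure \<Rightarrow> (real \<Rightarrow> 'a \<Rightarrow> real) \<Rightarrow> bool" where
  "brownian_setting M W \<longleftrightarrow>
     prob_space M \<and>
     (\<forall>A N. N \<in> null_sets M \<longrightarrow> A \<subseteq> N \<longrightarrow> A \<in> sets M) \<and>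
     sets M = sets (aug_filtration M W 1) \<and>
     (\<forall>t\<in>{0..1}. W t \<in> borel_measurable M) \<and>
     (\<forall>\<omega>\<in>space M. W 0 \<omega> = 0 \<and> continuous_on {0..1} (\<lambda>t. W t \<omega>)) \<and>
     (\<forall>s t. 0 \<le> s \<and> s < t \<and> t \<le> 1 \<longrightarrow>
        distributed M lborel (\<lambda>\<omega>. W t \<omega> - W s \<omega>) (\<lambda>x. ennreal (normal_density 0 (sqrt (t - s)) x))) \<and>
     (\<forall>(ts :: nat \<Rightarrow> real) n. ts 0 = 0 \<and> (\<forall>i<n. ts i < ts (Suc i)) \<and> ts n \<le> 1 \<longrightarrow>
        prob_space.indep_vars M (\<lambda>_. borel) (\<lambda>i \<omega>. W (ts (Suc i)) \<omega> - W (ts i) \<omega>) {..<n})"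

definition heat_F :: "'a measure \<Rightarrow> (real \<Rightarrow> 'a \<Rightarrow> real) \<Rightarrow> (real \<Rightarrow> real) \<Rightarrow> real \<Rightarrow> real \<Rightarrow> real" where
  "heat_F M W f t x = (\<integral>\<omega>. f (x + W (1 - t) \<omega>) \<partial>M)"

definition phi :: "'a measure \<Rightarrow> (real \<Rightarrow> 'a \<Rightarrow> real) \<Rightarrow> (real \<Rightarrow> real) \<Rightarrow> real \<Rightarrow> 'a \<Rightarrow> real" where
  "phi M W f t \<omega> = deriv (heat_F M W f t) (W t \<omega>)"

definition frac_I :: "real \<Rightarrow> (real \<Rightarrow> 'a \<Rightarrow> real) \<Rightarrow> real \<Rightarrow> 'a \<Rightarrow> real" where
  "frac_I \<alpha> Y t \<omega> = \<alpha> * (\<integral>u\<in>{0..1}. (1 - u) powr (\<alpha> - 1) * Y (min u t) \<omega> \<partial>lborel)"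

definition left_val :: "(real \<Rightarrow> 'a \<Rightarrow> real) \<Rightarrow> real \<Rightarrow> 'a \<Rightarrow> real" where
  "left_val Y a \<omega> = (if a = 0 then Y 0 \<omega> else Lim (at_left a) (\<lambda>t. Y t \<omega>))"

definition enn_sqrt :: "ennreal \<Rightarrow> ennreal" where
  "enn_sqrt x = (if x = \<top> then \<top> else ennreal (sqrt (enn2real x)))"

definition bmo2_norm :: "'a measure \<Rightarrow> (real \<Rightarrow> 'a measure) \<Rightarrow> (real \<Rightarrow> 'a \<Rightarrow> real) \<Rightarrow> ennreal" where
  "bmo2_norm M F Y = (SUP a\<in>{0..<1}. esssup M (\<lambda>\<omega>. enn_sqrt
      (nn_cond_exp M (F a)
         (\<lambda>\<omega>'. SUP t\<in>{a..<1}. ennreal ((Y t \<omega>' - left_val Y a \<omega>')\<^sup>2)) \<omega>)))"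

definition BMO2 :: "'a measure \<Rightarrow> (real \<Rightarrow> 'a measure) \<Rightarrow> (real \<Rightarrow> 'a \<Rightarrow> real) set" where
  "BMO2 M F = {Y. (\<forall>t\<in>{0..<1}. Y t \<in> borel_measurable (F t) \<and> integrable M (\<lambda>\<omega>. (Y t \<omega>)\<^sup>2)) \<and>
      (\<forall>\<omega>\<in>space M. \<forall>t\<in>{0..<1}. continuous (at_right t) (\<lambda>s. Y s \<omega>) \<and>
          (t > 0 \<longrightarrow> (\<exists>l. ((\<lambda>s. Y s \<omega>) \<longlongrightarrow> l) (at_left t)))) \<and>
      bmo2_norm M F Y < \<top>}"

end

theory Submission
  imports Defs
begin

text \<open>
  Take the lacunary series \<open>f(x) = \<Sum>\<^sub>k c\<^sub>k w\<^sub>k\<^bsup>-\<theta>\<^esup> sin (w\<^sub>k x)\<close> with \<open>w\<^sub>k\<close> geometric and \<open>c\<^sub>k = (k + 1)\<^bsup>-1/2\<^esup>\<close>.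
  Cutting the series at frequency \<open>1/\<lambda>\<close> shows \<open>\<lambda>\<^bsup>-\<theta>\<^esup> K(\<lambda>, f) \<le> C c\<^sub>n\<close> for \<open>w\<^sub>n \<approx> 1/\<lambda>\<close>, so \<open>f\<close> lies in
  the interpolation space for every \<open>q > 2\<close>, because \<open>c\<close> lies in \<open>\<ell>\<^sub>q\<close>.

  The gradient process is \<open>\<phi>\<^sub>t = \<Sum>\<^sub>k c\<^sub>k w\<^sub>k\<^bsup>1-\<theta>\<^esup> \<psi>\<^sub>k(t)\<close> with the martingales
  \<open>\<psi>\<^sub>k(t) = exp (-w\<^sub>k\<^sup>2(1-t)/2) cos (w\<^sub>k W\<^sub>t)\<close>, whose covariances
  \<open>E \<psi>\<^sub>k(u) \<psi>\<^sub>l(v) = exp (-(w\<^sub>k\<^sup>2 + w\<^sub>l\<^sup>2)/2) cosh (w\<^sub>k w\<^sub>l min(u,v))\<close> increase with \<open>min(u,v)\<close>. As the weight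
  \<open>\<alpha>(1-u)\<^bsup>\<alpha>-1\<^esup>du\<close> is a probability measure on \<open>[0,1]\<close>, the second moment of \<open>I\<^sub>t\<phi> - \<phi>\<^sub>0\<close> is a double
  integral of covariances of the increments \<open>\<phi>\<^bsub>min(u,t)\<^esub> - \<phi>\<^sub>0\<close>. All contributions are nonnegative; keeping only
  the diagonal ones with \<open>u, v \<ge> 1 - w\<^sub>k\<^bsup>-2\<^esup>\<close> bounds it below by a multiple of the partial sums of
  \<open>\<Sum>\<^sub>k c\<^sub>k\<^sup>2 = \<infinity>\<close>. So the BMO condition already fails at \<open>a = 0\<close>.
\<close>

subsection \<open>Covariances of damped cosines of Brownian motion\<close>

lemma (in prob_space) integrable_if_abs_le:
  fixes g :: "'a \<Rightarrow> real"
  assumes "g \<in> borel_measurable M" "\<And>\<omega>. \<omega> \<in> space M \<Longrightarrow> \<bar>g \<omega>\<bar> \<le> B"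
  shows "integrable M g"
  using assms by (intro integrable_const_bound[of _ B]) auto

text \<open>Dividing \<open>X\<close> by its standard deviation turns the expectation into the
  characteristic function of the standard normal law at \<open>c * \<sigma>\<close>.\<close>

lemma (in prob_space) expectation_iexp_normal:
  assumes D: "distributed M lborel X (\<lambda>x. ennreal (normal_density 0 \<sigma> x))" and \<sigma>: "0 < \<sigma>"
  shows "expectation (\<lambda>\<omega>. iexp (c * X \<omega>)) = of_real (exp (- (c\<^sup>2 * \<sigma>\<^sup>2 / 2)))"
proof -
  have D': "distributed M lborel (\<lambda>x. X x / \<sigma>) std_normal_density"
    using normal_standard_normal_convert[OF \<sigma>, of X 0] D by simp
  have "expectation (\<lambda>\<omega>. iexp (c * X \<omega>)) = expectation (\<lambda>\<omega>. iexp ((c * \<sigma>) * (X \<omega> / \<sigma>)))"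
    using \<sigma> by simp
  also have "\<dots> = (CLINT x|distr M lborel (\<lambda>x. X x / \<sigma>). iexp ((c * \<sigma>) * x))"
    using distributed_measurable[OF D'] by (subst integral_distr) auto
  also have "\<dots> = char std_normal_distribution (c * \<sigma>)"
    unfolding char_def distributed_distr_eq_density[OF D'] ..
  also have "\<dots> = of_real (exp (- (c\<^sup>2 * \<sigma>\<^sup>2 / 2)))"
    by (simp add: char_std_normal_distribution power_mult_distrib)
  finally show ?thesis .
qed

locale brownian =
  fixes M :: "'a measure" and W :: "real \<Rightarrow> 'a \<Rightarrow> real"
  assumes setting: "brownian_setting M W"

sublocale brownian \<subseteq> prob_space M
  using setting unfolding brownian_setting_def by blast

context brownian
begin

lemma W_measurable: "t \<in> {0..1} \<Longrightarrow> W t \<in> borel_measurable M"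
  using setting unfolding brownian_setting_def by blast

lemma W_0: "\<omega> \<in> space M \<Longrightarrow> W 0 \<omega> = 0"
  using setting unfolding brownian_setting_def by blast

lemma W_continuous: "\<omega> \<in> space M \<Longrightarrow> continuous_on {0..1} (\<lambda>t. W t \<omega>)"
  using setting unfolding brownian_setting_def by blast

text \<open>The setting gives a density only for \<open>s < t\<close>; the trivial case
  \<open>s = t\<close> is added so that the later formulas hold for all
  \<open>u \<le> v\<close>.\<close>

lemma expectation_iexp_increment:
  assumes "0 \<le> s" "s \<le> t" "t \<le> 1"
  shows "expectation (\<lambda>\<omega>. iexp (c * (W t \<omega> - W s \<omega>))) = of_real (exp (- (c\<^sup>2 * (t - s) / 2)))"
proof (cases "s = t")
  case True
  then show ?thesis by (simp add: prob_space)
next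
  case False
  have "distributed M lborel (\<lambda>\<omega>. W t \<omega> - W s \<omega>)
          (\<lambda>x. ennreal (normal_density 0 (sqrt (t - s)) x))"
    using setting assms False unfolding brownian_setting_def by auto
  from expectation_iexp_normal[OF this, of c] show ?thesis
    using assms False by simp
qed

text \<open>The increments over \<open>[0, u]\<close> and \<open>[u, v]\<close> are independent, so
  the expectation factorises. The setting states independence for strictly increasing partitions
  only, hence the separate cases \<open>u = 0\<close> and \<open>u = v\<close>.\<close>

lemma expectation_iexp_two_increments:
  assumes "0 \<le> u" "u \<le> v" "v \<le> 1"
  shows "expectation (\<lambda>\<omega>. iexp (a * W u \<omega> + b * (W v \<omega> - W u \<omega>)))
       = of_real (exp (- ((a\<^sup>2 * u + b\<^sup>2 * (v - u)) / 2)))"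
proof -
  have cu: "expectation (\<lambda>\<omega>. iexp (a * W u \<omega>)) = of_real (exp (- (a\<^sup>2 * u / 2)))"
  proof -
    have "expectation (\<lambda>\<omega>. iexp (a * W u \<omega>)) = expectation (\<lambda>\<omega>. iexp (a * (W u \<omega> - W 0 \<omega>)))"
      by (intro Bochner_Integration.integral_cong) (auto simp: W_0)
    then show ?thesis
      using expectation_iexp_increment[of 0 u a] assms by simp
  qed
  note cv = expectation_iexp_increment[OF assms, of b]
  consider "u = 0" | "u = v" | "0 < u" "u < v"
    using assms by force
  then show ?thesis
  proof cases
    case 1
    have "expectation (\<lambda>\<omega>. iexp (a * W u \<omega> + b * (W v \<omega> - W u \<omega>)))
        = expectation (\<lambda>\<omega>. iexp (b * (W v \<omega> - W u \<omega>)))"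
      using 1 by (intro Bochner_Integration.integral_cong) (auto simp: W_0)
    then show ?thesis using cv 1 by simp
  next
    case 2
    then show ?thesis using cu by simp
  next
    case 3
    \<comment> \<open>The partition \<open>0 < u < v\<close>; only the indices up to 2
      matter.\<close>
    define ts :: "nat \<Rightarrow> real" where "ts = (\<lambda>i. if i = 0 then 0 else if i = 1 then u else v)"
    have ts: "ts 0 = 0" "ts (Suc 0) = u" "ts (Suc (Suc 0)) = v"
      by (auto simp: ts_def)
    have "ts 0 = 0 \<and> (\<forall>i<2. ts i < ts (Suc i)) \<and> ts 2 \<le> 1"
      using 3 assms by (auto simp: ts_def)
    then have "indep_vars (\<lambda>_. borel) (\<lambda>i \<omega>. W (ts (Suc i)) \<omega> - W (ts i) \<omega>) {..<2::nat}"
      using setting unfolding brownian_setting_def by blast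
    then have ind: "indep_vars (\<lambda>_. borel)
        (\<lambda>i \<omega>. iexp ((if i = 0 then a else b) * (W (ts (Suc i)) \<omega> - W (ts i) \<omega>))) {..<2::nat}"
      by (rule indep_vars_compose2[where Y = "\<lambda>i x. iexp ((if i = (0::nat) then a else b) * x)"]) measurable
    have int: "integrable M (\<lambda>\<omega>. iexp ((if i = 0 then a else b) * (W (ts (Suc i)) \<omega> - W (ts i) \<omega>)))"
      if "i \<in> {..<2::nat}" for i
    proof (rule integrable_const_bound[of _ 1])
      show "random_variable borel (\<lambda>\<omega>. iexp ((if i = 0 then a else b) * (W (ts (Suc i)) \<omega> - W (ts i) \<omega>)))"
        using ind that unfolding indep_vars_def by blast
    qed (rule AE_I2, simp only: norm_exp_i_times order_refl)
    have "expectation (\<lambda>\<omega>. \<Prod>i<2::nat. iexp ((if i = 0 then a else b) * (W (ts (Suc i)) \<omega> - W (ts i) \<omega>)))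
        = (\<Prod>i<2::nat. expectation (\<lambda>\<omega>. iexp ((if i = 0 then a else b) * (W (ts (Suc i)) \<omega> - W (ts i) \<omega>))))"
      by (rule indep_vars_lebesgue_integral[OF _ ind int]) auto
    then have "expectation (\<lambda>\<omega>. iexp (a * (W u \<omega> - W 0 \<omega>)) * iexp (b * (W v \<omega> - W u \<omega>)))
        = expectation (\<lambda>\<omega>. iexp (a * (W u \<omega> - W 0 \<omega>))) * expectation (\<lambda>\<omega>. iexp (b * (W v \<omega> - W u \<omega>)))"
      by (simp add: numeral_2_eq_2 ts)
    moreover have "expectation (\<lambda>\<omega>. iexp (a * W u \<omega> + b * (W v \<omega> - W u \<omega>)))
      = expectation (\<lambda>\<omega>. iexp (a * (W u \<omega> - W 0 \<omega>)) * iexp (b * (W v \<omega> - W u \<omega>)))"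
      by (intro Bochner_Integration.integral_cong) (auto simp: W_0 exp_add[symmetric] algebra_simps)
    moreover have "expectation (\<lambda>\<omega>. iexp (a * (W u \<omega> - W 0 \<omega>))) = of_real (exp (- (a\<^sup>2 * u / 2)))"
      using expectation_iexp_increment[of 0 u a] assms by simp
    ultimately show ?thesis
      using cv by (simp add: exp_add[symmetric] of_real_mult[symmetric] algebra_simps add_divide_distrib diff_divide_distrib del: of_real_mult)
  qed
qed

lemma expectation_cos_two_increments:
  assumes "0 \<le> u" "u \<le> v" "v \<le> 1"
  shows "expectation (\<lambda>\<omega>. cos (a * W u \<omega> + b * (W v \<omega> - W u \<omega>)))
       = exp (- ((a\<^sup>2 * u + b\<^sup>2 * (v - u)) / 2))"
    and "expectation (\<lambda>\<omega>. sin (a * W u \<omega> + b * (W v \<omega> - W u \<omega>))) = 0"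
proof -
  have [measurable]: "W u \<in> borel_measurable M" "W v \<in> borel_measurable M"
    using assms by (auto intro!: W_measurable)
  have int: "integrable M (\<lambda>\<omega>. iexp (a * W u \<omega> + b * (W v \<omega> - W u \<omega>)))"
    by (intro integrable_const_bound[of _ 1]) (auto simp: norm_exp_i_times simp del: of_real_add of_real_mult)
  note E = expectation_iexp_two_increments[OF assms, of a b]
  have "Re (expectation (\<lambda>\<omega>. iexp (a * W u \<omega> + b * (W v \<omega> - W u \<omega>))))
      = expectation (\<lambda>\<omega>. cos (a * W u \<omega> + b * (W v \<omega> - W u \<omega>)))"
    by (subst integral_Re[symmetric, OF int]) (simp add: Re_exp)
  with E show "expectation (\<lambda>\<omega>. cos (a * W u \<omega> + b * (W v \<omega> - W u \<omega>)))
       = exp (- ((a\<^sup>2 * u + b\<^sup>2 * (v - u)) / 2))"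
    by simp
  have "Im (expectation (\<lambda>\<omega>. iexp (a * W u \<omega> + b * (W v \<omega> - W u \<omega>))))
      = expectation (\<lambda>\<omega>. sin (a * W u \<omega> + b * (W v \<omega> - W u \<omega>)))"
    by (subst integral_Im[symmetric, OF int]) (simp add: Im_exp)
  with E show "expectation (\<lambda>\<omega>. sin (a * W u \<omega> + b * (W v \<omega> - W u \<omega>))) = 0"
    by simp
qed

text \<open>This is the martingale of conditional expectations of \<open>cos (l * W 1)\<close> given
  the past up to time \<open>u\<close>.\<close>

definition osc :: "real \<Rightarrow> real \<Rightarrow> 'a \<Rightarrow> real" where
  "osc l u \<omega> = exp (- (l\<^sup>2 * (1 - u) / 2)) * cos (l * W u \<omega>)"

text \<open>The product of the two cosines is half a sum of cosines, each of a linear combination of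
  the independent increments \<open>W u\<close> and \<open>W v - W u\<close>, whose expectations are
  known.\<close>

lemma expectation_osc_mult:
  assumes "0 \<le> u" "u \<le> 1" "0 \<le> v" "v \<le> 1"
  shows "expectation (\<lambda>\<omega>. osc l u \<omega> * osc m v \<omega>)
       = exp (- ((l\<^sup>2 + m\<^sup>2) / 2)) * cosh (l * m * min u v)"
proof -
  have main: "expectation (\<lambda>\<omega>. osc l u \<omega> * osc m v \<omega>)
       = exp (- ((l\<^sup>2 + m\<^sup>2) / 2)) * cosh (l * m * u)"
    if "0 \<le> u" "u \<le> v" "v \<le> 1" for u v l m
  proof -
    have [measurable]: "W u \<in> borel_measurable M" "W v \<in> borel_measurable M"
      using that by (auto intro!: W_measurable)
    have eq: "osc l u \<omega> * osc m v \<omega> = exp (- (l\<^sup>2 * (1 - u) / 2) - m\<^sup>2 * (1 - v) / 2) / 2 *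
       (cos ((l - m) * W u \<omega> + (- m) * (W v \<omega> - W u \<omega>)) + cos ((l + m) * W u \<omega> + m * (W v \<omega> - W u \<omega>)))" for \<omega>
    proof -
      have "cos (l * W u \<omega>) * cos (m * W v \<omega>) = (cos (l * W u \<omega> - m * W v \<omega>) + cos (l * W u \<omega> + m * W v \<omega>)) / 2"
        by (rule cos_times_cos)
      moreover have "l * W u \<omega> - m * W v \<omega> = (l - m) * W u \<omega> + (- m) * (W v \<omega> - W u \<omega>)"
        "l * W u \<omega> + m * W v \<omega> = (l + m) * W u \<omega> + m * (W v \<omega> - W u \<omega>)"
        by (auto simp: algebra_simps)
      ultimately have c: "cos (l * W u \<omega>) * cos (m * W v \<omega>) =
        (cos ((l - m) * W u \<omega> + (- m) * (W v \<omega> - W u \<omega>)) + cos ((l + m) * W u \<omega> + m * (W v \<omega> - W u \<omega>))) / 2"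
        by simp
      have "osc l u \<omega> * osc m v \<omega> =
          exp (- (l\<^sup>2 * (1 - u) / 2) - m\<^sup>2 * (1 - v) / 2) * (cos (l * W u \<omega>) * cos (m * W v \<omega>))"
        unfolding osc_def by (simp add: exp_add[symmetric])
      then show ?thesis unfolding c by simp
    qed
    have int: "integrable M (\<lambda>\<omega>. cos (a * W u \<omega> + b * (W v \<omega> - W u \<omega>)))" for a b
      by (rule integrable_if_abs_le[of _ 1]) auto
    have "expectation (\<lambda>\<omega>. osc l u \<omega> * osc m v \<omega>) = exp (- (l\<^sup>2 * (1 - u) / 2) - m\<^sup>2 * (1 - v) / 2) / 2 *
        (exp (- (((l - m)\<^sup>2 * u + (- m)\<^sup>2 * (v - u)) / 2)) + exp (- (((l + m)\<^sup>2 * u + m\<^sup>2 * (v - u)) / 2)))"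
      unfolding eq
      by (simp only: integral_mult_right_zero Bochner_Integration.integral_add[OF int int]
          expectation_cos_two_increments[OF that])
    \<comment> \<open>The later time \<open>v\<close> cancels from both exponents, as the martingale
      property predicts.\<close>
    also have "\<dots> = (exp (- ((l\<^sup>2 + m\<^sup>2) / 2) + l * m * u) + exp (- ((l\<^sup>2 + m\<^sup>2) / 2) - l * m * u)) / 2"
    proof -
      have "- (l\<^sup>2 * (1 - u) / 2) - m\<^sup>2 * (1 - v) / 2 + - (((l - m)\<^sup>2 * u + (- m)\<^sup>2 * (v - u)) / 2)
          = - ((l\<^sup>2 + m\<^sup>2) / 2) + l * m * u"
        "- (l\<^sup>2 * (1 - u) / 2) - m\<^sup>2 * (1 - v) / 2 + - (((l + m)\<^sup>2 * u + m\<^sup>2 * (v - u)) / 2)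
          = - ((l\<^sup>2 + m\<^sup>2) / 2) - l * m * u"
        by (simp_all add: power2_eq_square field_simps)
      then show ?thesis
        by (simp only: distrib_left exp_add[symmetric] times_divide_eq_left times_divide_eq_right add_divide_distrib)
    qed
    also have "\<dots> = exp (- ((l\<^sup>2 + m\<^sup>2) / 2)) * cosh (l * m * u)"
      by (simp add: cosh_def exp_add[symmetric] distrib_left)
    finally show ?thesis .
  qed
  show ?thesis
  proof (cases "u \<le> v")
    case True
    then show ?thesis using main[of u v l m] assms by (simp add: min_def)
  next
    case False
    then show ?thesis using main[of v u m l] assms
      by (simp add: min_def mult.commute add.commute mult.left_commute)
  qed
qed

end

subsection \<open>Fractional averages of processes\<close>

text \<open>Rounding \<open>u\<close> down to a grid of mesh \<open>1 / (n + 1)\<close> gives a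
  function glued from countably many measurable pieces; path continuity makes these functions
  converge pointwise. The joint measurability is what Fubini asks for.\<close>

lemma borel_measurable_pair_if_continuous:
  fixes Z :: "real \<Rightarrow> 'a \<Rightarrow> real"
  assumes meas: "\<And>u. Z u \<in> borel_measurable M"
    and cont: "\<And>\<omega>. \<omega> \<in> space M \<Longrightarrow> continuous_on UNIV (\<lambda>u. Z u \<omega>)"
  shows "(\<lambda>(\<omega>, u). Z u \<omega>) \<in> borel_measurable (M \<Otimes>\<^sub>M borel)"
proof (rule borel_measurable_LIMSEQ_real)
  define r :: "nat \<Rightarrow> real \<Rightarrow> real" where "r n u = of_int \<lfloor>of_nat (Suc n) * u\<rfloor> / of_nat (Suc n)" for n u
  show "(\<lambda>n. case x of (\<omega>, u) \<Rightarrow> Z (r n u) \<omega>) \<longlonglongrightarrow> (case x of (\<omega>, u) \<Rightarrow> Z u \<omega>)"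
    if x': "x \<in> space (M \<Otimes>\<^sub>M borel)" for x
  proof -
    obtain \<omega> u where x: "x = (\<omega>, u)" "\<omega> \<in> space M"
      using x' by (auto simp: space_pair_measure)
    have "(\<lambda>n. r n u) \<longlonglongrightarrow> u"
    proof (rule Lim_null[THEN iffD2], rule Lim_null_comparison)
      show "(\<lambda>n. inverse (real (Suc n))) \<longlonglongrightarrow> 0"
        by (rule LIMSEQ_inverse_real_of_nat)
      show "\<forall>\<^sub>F n in sequentially. norm (r n u - u) \<le> inverse (real (Suc n))"
      proof (rule always_eventually, rule allI)
        fix n
        define N where "N = real (Suc n)"
        have N: "N > 0" by (simp add: N_def)
        have "\<bar>of_int \<lfloor>N * u\<rfloor> - N * u\<bar> \<le> 1" by linarith
        moreover have "r n u - u = (of_int \<lfloor>N * u\<rfloor> - N * u) / N"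
          using N by (simp add: r_def N_def field_simps del: of_nat_Suc)
        ultimately show "norm (r n u - u) \<le> inverse (real (Suc n))"
          using N unfolding N_def[symmetric] by (simp add: abs_divide divide_right_mono inverse_eq_divide)
      qed
    qed
    then show ?thesis
      using cont[OF x(2)] x(1) by (auto simp: continuous_on_eq_continuous_at intro: isCont_tendsto_compose)
  qed
  fix n
  show "(\<lambda>(\<omega>, u). Z (r n u) \<omega>) \<in> borel_measurable (M \<Otimes>\<^sub>M borel)"
  proof -
    define N where "N = real (Suc n)"
    have "(\<lambda>x. \<lfloor>N * snd x\<rfloor>) \<in> measurable (M \<Otimes>\<^sub>M borel) (count_space UNIV)"
      by (rule measurable_compose[OF _ measurable_real_floor]) measurable
    then have "(\<lambda>x. Z (of_int \<lfloor>N * snd x\<rfloor> / N) (fst x)) \<in> borel_measurable (M \<Otimes>\<^sub>M borel)"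
      by (rule measurable_compose_countable[where f = "\<lambda>i x. Z (of_int i / N) (fst x)", rotated])
        (rule measurable_compose[OF measurable_fst meas])
    then show ?thesis
      by (simp add: r_def N_def case_prod_beta)
  qed
qed

text \<open>One factor of the square is pulled into the other integral and Fubini is applied twice;
  boundedness on a product of probability spaces supplies integrability.\<close>

lemma expectation_square_of_integral:
  fixes X :: "real \<Rightarrow> 'a \<Rightarrow> real" and R :: "real measure"
  assumes "prob_space M" "prob_space R"
    and meas: "(\<lambda>(\<omega>, u). X u \<omega>) \<in> borel_measurable (M \<Otimes>\<^sub>M R)"
    and bound: "\<And>\<omega> u. \<omega> \<in> space M \<Longrightarrow> \<bar>X u \<omega>\<bar> \<le> B"
  shows "(\<integral>\<omega>. (\<integral>u. X u \<omega> \<partial>R)\<^sup>2 \<partial>M) = (\<integral>u. (\<integral>v. (\<integral>\<omega>. X u \<omega> * X v \<omega> \<partial>M) \<partial>R) \<partial>R)"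
proof -
  interpret M: prob_space M by fact
  interpret R: prob_space R by fact
  interpret P: pair_prob_space M R ..
  note meas[measurable]
  have Xu[measurable]: "X u \<in> borel_measurable M" if "u \<in> space R" for u
    using measurable_Pair1[OF meas that] by simp
  have Xw[measurable]: "(\<lambda>u. X u \<omega>) \<in> borel_measurable R" if "\<omega> \<in> space M" for \<omega>
    using measurable_Pair2[OF meas that] by simp
  define Z where "Z \<omega> = (\<integral>u. X u \<omega> \<partial>R)" for \<omega>
  have Zm[measurable]: "Z \<in> borel_measurable M"
    unfolding Z_def by measurable
  have B: "0 \<le> B"
    using M.not_empty bound by fastforce
  have Zb: "\<bar>Z \<omega>\<bar> \<le> B" if "\<omega> \<in> space M" for \<omega>
  proof -
    have "\<bar>Z \<omega>\<bar> \<le> (\<integral>u. \<bar>X u \<omega>\<bar> \<partial>R)"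
      unfolding Z_def by (rule integral_abs_bound)
    also have "\<dots> \<le> (\<integral>u. B \<partial>R)"
      using bound[OF that] Xw[OF that] B by (intro integral_mono R.integrable_const_bound[of _ B]) auto
    finally show ?thesis by (simp add: R.prob_space)
  qed
  have 1: "(\<integral>\<omega>. (Z \<omega>)\<^sup>2 \<partial>M) = (\<integral>\<omega>. (\<integral>u. X u \<omega> * Z \<omega> \<partial>R) \<partial>M)"
    by (simp add: Z_def power2_eq_square)
  \<comment> \<open>Fubini with a bounded factor \<open>Y\<close> free of \<open>u\<close>, used
    once with \<open>Y\<close> the averaged process \<open>Z\<close> and once with \<open>Y\<close>
    a single \<open>X u\<close>.\<close>
  have 2: "(\<integral>\<omega>. (\<integral>u. X u \<omega> * Y \<omega> \<partial>R) \<partial>M) = (\<integral>u. (\<integral>\<omega>. X u \<omega> * Y \<omega> \<partial>M) \<partial>R)"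
    if [measurable]: "Y \<in> borel_measurable M" and Y: "\<And>\<omega>. \<omega> \<in> space M \<Longrightarrow> \<bar>Y \<omega>\<bar> \<le> B" for Y
  proof (rule P.Fubini_integral[symmetric])
    show "integrable (M \<Otimes>\<^sub>M R) (\<lambda>(\<omega>, u). X u \<omega> * Y \<omega>)"
    proof (rule P.integrable_const_bound[of _ "B * B"])
      show "AE x in M \<Otimes>\<^sub>M R. norm (case x of (\<omega>, u) \<Rightarrow> X u \<omega> * Y \<omega>) \<le> B * B"
        using bound Y B by (auto intro!: AE_I2 mult_mono simp: space_pair_measure abs_mult)
      have "(\<lambda>x. (case x of (\<omega>, u) \<Rightarrow> X u \<omega>) * Y (fst x)) \<in> borel_measurable (M \<Otimes>\<^sub>M R)"
        by measurable
      then show "(\<lambda>(\<omega>, u). X u \<omega> * Y \<omega>) \<in> borel_measurable (M \<Otimes>\<^sub>M R)"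
        by (simp add: case_prod_beta)
    qed
  qed
  have "(\<integral>\<omega>. X u \<omega> * Z \<omega> \<partial>M) = (\<integral>v. (\<integral>\<omega>. X u \<omega> * X v \<omega> \<partial>M) \<partial>R)" if u: "u \<in> space R" for u
  proof -
    have "(\<integral>\<omega>. X u \<omega> * Z \<omega> \<partial>M) = (\<integral>\<omega>. (\<integral>v. X v \<omega> * X u \<omega> \<partial>R) \<partial>M)"
      by (simp add: Z_def mult.commute)
    also have "\<dots> = (\<integral>v. (\<integral>\<omega>. X v \<omega> * X u \<omega> \<partial>M) \<partial>R)"
      using bound by (intro 2 Xu u) auto
    finally show ?thesis by (simp add: mult.commute)
  qed
  then have "(\<integral>u. (\<integral>\<omega>. X u \<omega> * Z \<omega> \<partial>M) \<partial>R) = (\<integral>u. (\<integral>v. (\<integral>\<omega>. X u \<omega> * X v \<omega> \<partial>M) \<partial>R) \<partial>R)"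
    by (intro Bochner_Integration.integral_cong) auto
  with 1 2[OF Zm Zb] show ?thesis
    by (simp add: Z_def)
qed

section \<open>The fractional weight as a Beta(1, \<alpha>) law\<close>

definition frac_kernel :: "real \<Rightarrow> real measure" where
  "frac_kernel \<alpha> = density lborel (\<lambda>u. ennreal (indicator {0..1} u * (\<alpha> * (1 - u) powr (\<alpha> - 1))))"

lemma sets_frac_kernel[measurable_cong, simp]: "sets (frac_kernel \<alpha>) = sets borel"
  by (simp add: frac_kernel_def)

lemma space_frac_kernel[simp]: "space (frac_kernel \<alpha>) = UNIV"
  by (simp add: frac_kernel_def)

text \<open>The density has the antiderivative \<open>- ((1 - u) powr \<alpha>)\<close>. For
  \<alpha> < 1 it blows up at 1, so the fundamental theorem is applied on the open interval with
  limits at its ends.\<close>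

lemma emeasure_frac_kernel:
  assumes \<alpha>: "0 < \<alpha>" and s: "0 \<le> s" "s < 1"
  shows "emeasure (frac_kernel \<alpha>) {s..} = ennreal ((1 - s) powr \<alpha>)"
proof -
  have f1: "ereal s < 1" using s by simp
  have f2: "DERIV (\<lambda>u. - ((1 - u) powr \<alpha>)) x :> \<alpha> * (1 - x) powr (\<alpha> - 1)" if "ereal s < ereal x" "ereal x < 1" for x
    using that by (auto intro!: derivative_eq_intros simp: one_ereal_def)
  have f3: "isCont (\<lambda>u. \<alpha> * (1 - u) powr (\<alpha> - 1)) x" if "ereal s < ereal x" "ereal x < 1" for x
    using that by (auto intro!: continuous_intros simp: one_ereal_def)
  have f4: "AE x in lborel. ereal s < ereal x \<longrightarrow> ereal x < 1 \<longrightarrow> 0 \<le> \<alpha> * (1 - x) powr (\<alpha> - 1)"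
    using \<alpha> by simp
  have "((\<lambda>u. - ((1 - u) powr \<alpha>)) \<longlongrightarrow> - ((1 - s) powr \<alpha>)) (at_right s)"
    using s by (intro tendsto_intros) auto
  then have f5: "(((\<lambda>u. - ((1 - u) powr \<alpha>)) \<circ> real_of_ereal) \<longlongrightarrow> - ((1 - s) powr \<alpha>)) (at_right (ereal s))"
    by (simp add: ereal_tendsto_simps)
  \<comment> \<open>At 1 the base of \<open>powr\<close> tends to 0; the limit follows from \<alpha>
    > 0 and from the base being eventually nonnegative.\<close>
  have "\<forall>\<^sub>F u in at_left (1::real). 0 \<le> 1 - u"
    by (auto simp: eventually_at_filter)
  then have "((\<lambda>u. - ((1 - u) powr \<alpha>)) \<longlongrightarrow> - ((1 - 1) powr \<alpha>)) (at_left (1::real))"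
    using \<alpha> by (intro tendsto_minus tendsto_powr' tendsto_intros) auto
  then have f6: "(((\<lambda>u. - ((1 - u) powr \<alpha>)) \<circ> real_of_ereal) \<longlongrightarrow> 0) (at_left (1::ereal))"
    unfolding one_ereal_def by (simp add: ereal_tendsto_simps)
  note F = interval_integral_FTC_nonneg[OF f1 f2 f3 f4 f5 f6]
  have ei: "einterval (ereal s) 1 = {s<..<1}"
    by (auto simp: einterval_def one_ereal_def)
  have "emeasure (frac_kernel \<alpha>) {s..}
      = (\<integral>\<^sup>+u. ennreal (indicator {0..1} u * (\<alpha> * (1 - u) powr (\<alpha> - 1))) * indicator {s..} u \<partial>lborel)"
    unfolding frac_kernel_def by (rule emeasure_density) auto
  also have "\<dots> = (\<integral>\<^sup>+u. ennreal (indicator {s<..<1} u * (\<alpha> * (1 - u) powr (\<alpha> - 1))) \<partial>lborel)"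
  proof (rule nn_integral_cong_AE)
    show "AE u in lborel. ennreal (indicator {0..1} u * (\<alpha> * (1 - u) powr (\<alpha> - 1))) * indicator {s..} u
        = ennreal (indicator {s<..<1} u * (\<alpha> * (1 - u) powr (\<alpha> - 1)))"
      using AE_lborel_singleton[of s] AE_lborel_singleton[of 1]
      by eventually_elim (use s in \<open>auto simp: indicator_def\<close>)
  qed
  also have "\<dots> = ennreal (\<integral>u. indicator {s<..<1} u * (\<alpha> * (1 - u) powr (\<alpha> - 1)) \<partial>lborel)"
    using F(1) \<alpha> unfolding ei set_integrable_def by (intro nn_integral_eq_integral) auto
  also have "(\<integral>u. indicator {s<..<1} u * (\<alpha> * (1 - u) powr (\<alpha> - 1)) \<partial>lborel) = (1 - s) powr \<alpha>"
    using F(2) s by (simp add: interval_lebesgue_integral_def ei set_lebesgue_integral_def mult.left_commute[of _ \<alpha>])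
  finally show ?thesis .
qed

lemma measure_frac_kernel:
  assumes "0 < \<alpha>" "0 \<le> s" "s < 1"
  shows "measure (frac_kernel \<alpha>) {s..} = (1 - s) powr \<alpha>"
  using emeasure_frac_kernel[OF assms] by (simp add: measure_def)

lemma prob_space_frac_kernel:
  assumes "0 < \<alpha>"
  shows "prob_space (frac_kernel \<alpha>)"
proof
  have "emeasure (frac_kernel \<alpha>) UNIV
      = (\<integral>\<^sup>+u. ennreal (indicator {0..1} u * (\<alpha> * (1 - u) powr (\<alpha> - 1))) \<partial>lborel)"
    unfolding frac_kernel_def by (subst emeasure_density) auto
  also have "\<dots> = emeasure (frac_kernel \<alpha>) {0..}"
    unfolding frac_kernel_def
    by (subst emeasure_density) (auto intro!: nn_integral_cong simp: indicator_def)
  also have "\<dots> = 1"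
    using emeasure_frac_kernel[OF assms, of 0] by simp
  finally show "emeasure (frac_kernel \<alpha>) (space (frac_kernel \<alpha>)) = 1"
    by simp
qed

subsection \<open>The gradient process of a sine series\<close>

text \<open>For \<open>u \<ge> 0\<close> and \<open>t \<ge> 0\<close> this is
  \<open>min u t\<close>. Cutting below at 0 as well keeps the time in \<open>[0, t]\<close> for
  every real \<open>u\<close>, so that paths become continuous functions on the whole line.\<close>

definition clip :: "real \<Rightarrow> real \<Rightarrow> real" where
  "clip t u = max 0 (min u t)"

lemma clip_bounds: "0 \<le> t \<Longrightarrow> 0 \<le> clip t u" "0 \<le> t \<Longrightarrow> clip t u \<le> t"
  by (auto simp: clip_def)

text \<open>At distance \<open>e\<close> from the terminal time the Gaussian damping beats the
  factor \<open>w\<close> that differentiation produces, uniformly in \<open>w\<close>. The proof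
  combines \<open>\<bar>w\<bar> \<le> 1 + w^2\<close> with \<open>1 + y \<le> exp y\<close>.\<close>

lemma abs_mult_exp_square_le:
  fixes w e :: real
  assumes "0 < e"
  shows "\<bar>w\<bar> * exp (- (w\<^sup>2 * e / 2)) \<le> 1 + 2 / e"
proof -
  have "\<bar>w\<bar> \<le> 1 + w\<^sup>2"
    using zero_le_power2[of "\<bar>w\<bar> - 1"] by (simp add: power2_diff)
  also have "\<dots> \<le> (1 + 2 / e) * (1 + w\<^sup>2 * e / 2)"
    using assms by (simp add: field_simps)
  also have "\<dots> \<le> (1 + 2 / e) * exp (w\<^sup>2 * e / 2)"
    using assms exp_ge_add_one_self[of "w\<^sup>2 * e / 2"] by (intro mult_left_mono) auto
  finally show ?thesis
    by (simp add: exp_minus field_simps)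
qed

text \<open>Summability of \<open>a\<close> justifies the termwise operations on the series;
  nonnegativity of \<open>a\<close> and \<open>w\<close> makes all covariances of increments
  nonnegative.\<close>

locale brownian_series = brownian +
  fixes a w :: "nat \<Rightarrow> real"
  assumes a_nonneg: "0 \<le> a k" and a_summable: "summable a" and w_nonneg: "0 \<le> w k"
begin

definition sine_series :: "real \<Rightarrow> real" where
  "sine_series x = (\<Sum>k. a k * sin (w k * x))"

lemma abs_w_osc_le:
  assumes "u \<le> t" "t < 1"
  shows "\<bar>w k * osc (w k) u \<omega>\<bar> \<le> 1 + 2 / (1 - t)"
proof -
  have "\<bar>w k * osc (w k) u \<omega>\<bar> \<le> \<bar>w k\<bar> * exp (- ((w k)\<^sup>2 * (1 - u) / 2))"
    unfolding osc_def abs_mult by (intro mult_left_mono) (auto simp: mult_left_le)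
  also have "\<dots> \<le> 1 + 2 / (1 - u)"
    using assms by (intro abs_mult_exp_square_le) auto
  also have "\<dots> \<le> 1 + 2 / (1 - t)"
    using assms by (simp add: frac_le)
  finally show ?thesis .
qed

text \<open>Each sine is an eigenfunction of the heat semigroup: Gaussian averaging with variance
  \<open>1 - t\<close> multiplies it by the damping factor, since the term with the odd function has
  mean 0. The sum and the expectation are exchanged because \<open>a\<close> dominates.\<close>

lemma heat_F_sine_series:
  assumes "0 \<le> t" "t \<le> 1"
  shows "heat_F M W sine_series t x = (\<Sum>k. a k * (exp (- ((w k)\<^sup>2 * (1 - t) / 2)) * sin (w k * x)))"
proof -
  have [measurable]: "W (1 - t) \<in> borel_measurable M"
    using assms by (intro W_measurable) auto
  have int: "integrable M (\<lambda>\<omega>. cos (l * W (1 - t) \<omega>))" "integrable M (\<lambda>\<omega>. sin (l * W (1 - t) \<omega>))" for l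
    by (auto intro!: integrable_if_abs_le[of _ 1])
  have E: "expectation (\<lambda>\<omega>. sin (l * (x + W (1 - t) \<omega>))) = exp (- (l\<^sup>2 * (1 - t) / 2)) * sin (l * x)" for l
  proof -
    have "expectation (\<lambda>\<omega>. sin (l * (x + W (1 - t) \<omega>)))
        = expectation (\<lambda>\<omega>. sin (l * x) * cos (l * W (1 - t) \<omega>) + cos (l * x) * sin (l * W (1 - t) \<omega>))"
      by (simp add: distrib_left sin_add)
    also have "\<dots> = sin (l * x) * expectation (\<lambda>\<omega>. cos (l * W (1 - t) \<omega>))
        + cos (l * x) * expectation (\<lambda>\<omega>. sin (l * W (1 - t) \<omega>))"
      using int[of l] by simp
    also have "\<dots> = exp (- (l\<^sup>2 * (1 - t) / 2)) * sin (l * x)"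
      using expectation_cos_two_increments[of "1 - t" "1 - t" l 0] assms by simp
    finally show ?thesis .
  qed
  have b: "\<bar>a k * sin (w k * y)\<bar> \<le> a k" for k y
    using a_nonneg[of k] by (simp add: abs_mult mult_left_le)
  have sm: "summable (\<lambda>k. \<bar>a k * sin (w k * y)\<bar>)" for y
    by (rule summable_comparison_test'[OF a_summable, of 0]) (use b in auto)
  have "heat_F M W sine_series t x = expectation (\<lambda>\<omega>. \<Sum>k. a k * sin (w k * (x + W (1 - t) \<omega>)))"
    by (simp add: heat_F_def sine_series_def)
  also have "\<dots> = (\<Sum>k. expectation (\<lambda>\<omega>. a k * sin (w k * (x + W (1 - t) \<omega>))))"
  proof (rule integral_suminf)
    show int: "integrable M (\<lambda>\<omega>. a k * sin (w k * (x + W (1 - t) \<omega>)))" for k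
      using b by (intro integrable_if_abs_le[of _ "a k"]) auto
    show "AE \<omega> in M. summable (\<lambda>k. norm (a k * sin (w k * (x + W (1 - t) \<omega>))))"
      using sm by simp
    have "expectation (\<lambda>\<omega>. norm (a k * sin (w k * (x + W (1 - t) \<omega>)))) \<le> a k" for k
      using b[of k] by (intro integral_le_const integrable_norm int) auto
    then show "summable (\<lambda>k. expectation (\<lambda>\<omega>. norm (a k * sin (w k * (x + W (1 - t) \<omega>)))))"
      by (intro summable_comparison_test'[OF a_summable, of 0]) auto
  qed
  finally show ?thesis by (simp add: E)
qed

text \<open>Termwise differentiation: for \<open>t < 1\<close> the damping bound makes the series of
  derivatives converge uniformly by the Weierstrass test.\<close>

lemma phi_sine_series:
  assumes "0 \<le> t" "t < 1"
  shows "phi M W sine_series t \<omega> = (\<Sum>k. a k * (w k * osc (w k) t \<omega>))"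
proof -
  define x0 where "x0 = W t \<omega>"
  have "((\<lambda>x. \<Sum>k. a k * (exp (- ((w k)\<^sup>2 * (1 - t) / 2)) * sin (w k * x))) has_field_derivative
      (\<Sum>k. a k * (w k * (exp (- ((w k)\<^sup>2 * (1 - t) / 2)) * cos (w k * x0))))) (at x0)"
  proof (rule has_field_derivative_series'(2)[where S = UNIV and ?x0.0 = 0
          and f = "\<lambda>k x. a k * (exp (- ((w k)\<^sup>2 * (1 - t) / 2)) * sin (w k * x))"
          and f' = "\<lambda>k x. a k * (w k * (exp (- ((w k)\<^sup>2 * (1 - t) / 2)) * cos (w k * x)))"])
    show "uniformly_convergent_on UNIV (\<lambda>n x. \<Sum>k<n. a k * (w k * (exp (- ((w k)\<^sup>2 * (1 - t) / 2)) * cos (w k * x))))"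
    proof (rule Weierstrass_m_test')
      show "summable (\<lambda>k. a k * (1 + 2 / (1 - t)))"
        by (intro summable_mult2 a_summable)
      show "norm (a k * (w k * (exp (- ((w k)\<^sup>2 * (1 - t) / 2)) * cos (w k * x)))) \<le> a k * (1 + 2 / (1 - t))" for k x
      proof -
        have "\<bar>w k\<bar> * exp (- ((w k)\<^sup>2 * (1 - t) / 2)) * \<bar>cos (w k * x)\<bar> \<le> (1 + 2 / (1 - t)) * 1"
          using assms by (intro mult_mono abs_mult_exp_square_le) auto
        then show ?thesis
          using a_nonneg[of k] by (simp add: abs_mult mult_left_mono mult.assoc)
      qed
    qed
  qed (auto intro!: derivative_eq_intros)
  moreover have "heat_F M W sine_series t = (\<lambda>x. \<Sum>k. a k * (exp (- ((w k)\<^sup>2 * (1 - t) / 2)) * sin (w k * x)))"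
    using heat_F_sine_series[of t] assms by auto
  ultimately have "deriv (heat_F M W sine_series t) x0
      = (\<Sum>k. a k * (w k * (exp (- ((w k)\<^sup>2 * (1 - t) / 2)) * cos (w k * x0))))"
    by (auto intro: DERIV_imp_deriv)
  then show ?thesis
    by (simp add: phi_def x0_def osc_def)
qed

section \<open>Increments of the gradient process and their covariances\<close>

definition incr :: "real \<Rightarrow> nat \<Rightarrow> real \<Rightarrow> 'a \<Rightarrow> real" where
  "incr t k u \<omega> = a k * (w k * osc (w k) (clip t u) \<omega>) - a k * (w k * osc (w k) 0 \<omega>)"

lemma abs_incr_le:
  assumes "0 \<le> t" "t < 1"
  shows "\<bar>incr t k u \<omega>\<bar> \<le> a k * (2 * (1 + 2 / (1 - t)))"
proof -
  have "\<bar>w k * osc (w k) (clip t u) \<omega> - w k * osc (w k) 0 \<omega>\<bar> \<le> 2 * (1 + 2 / (1 - t))"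
    using order_trans[OF abs_triangle_ineq4 add_mono[OF abs_w_osc_le[of "clip t u" t k \<omega>] abs_w_osc_le[of 0 t k \<omega>]]]
      assms clip_bounds[of t u] by simp
  then show ?thesis
    unfolding incr_def right_diff_distrib[symmetric]
    using a_nonneg[of k] by (simp add: abs_mult mult_left_mono)
qed

lemma osc_measurable: "u \<in> {0..1} \<Longrightarrow> osc l u \<in> borel_measurable M"
  unfolding osc_def using W_measurable[of u] by measurable

lemma osc_measurable_pair:
  assumes "0 \<le> t" "t \<le> 1"
  shows "(\<lambda>(\<omega>, u). osc l (clip t u) \<omega>) \<in> borel_measurable (M \<Otimes>\<^sub>M borel)"
proof (rule borel_measurable_pair_if_continuous)
  have c: "clip t u \<in> {0..1}" for u
    using clip_bounds[of t u] assms by auto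
  show "osc l (clip t u) \<in> borel_measurable M" for u
    by (rule osc_measurable[OF c])
  show "continuous_on UNIV (\<lambda>u. osc l (clip t u) \<omega>)" if "\<omega> \<in> space M" for \<omega>
  proof -
    have cc: "continuous_on UNIV (clip t)"
      unfolding clip_def by (intro continuous_intros)
    have "continuous_on UNIV (\<lambda>u. W (clip t u) \<omega>)"
      by (rule continuous_on_compose2[OF W_continuous[OF that] cc]) (use c in auto)
    then show ?thesis
      unfolding osc_def using cc by (intro continuous_intros) auto
  qed
qed

text \<open>The product expands into four covariances. The three that involve time 0 have
  \<open>cosh 0 = 1\<close> and enter with signs -, - and +, which leaves \<open>cosh\<close> of the
  common time minus 1.\<close>

lemma expectation_incr_mult:
  assumes "0 \<le> t" "t < 1"
  shows "expectation (\<lambda>\<omega>. incr t k u \<omega> * incr t l v \<omega>)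
    = a k * w k * (a l * w l) * exp (- (((w k)\<^sup>2 + (w l)\<^sup>2) / 2)) * (cosh (w k * w l * min (clip t u) (clip t v)) - 1)"
proof -
  note cb = clip_bounds[OF assms(1), of u] clip_bounds[OF assms(1), of v]
  have int: "integrable M (\<lambda>\<omega>. osc (w k) r \<omega> * osc (w l) s \<omega>)" if "0 \<le> r" "r \<le> 1" "0 \<le> s" "s \<le> 1" for r s
  proof (rule integrable_if_abs_le[of _ 1])
    show "(\<lambda>\<omega>. osc (w k) r \<omega> * osc (w l) s \<omega>) \<in> borel_measurable M"
      using that by (intro borel_measurable_times osc_measurable) auto
    have o: "\<bar>osc c r \<omega>\<bar> \<le> 1" if "r \<le> 1" for c r \<omega>
      using that unfolding osc_def abs_mult by (intro mult_le_one) auto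
    show "\<bar>osc (w k) r \<omega> * osc (w l) s \<omega>\<bar> \<le> 1" for \<omega>
      using o[OF that(2)] o[OF that(4)] unfolding abs_mult by (intro mult_le_one) auto
  qed
  have "expectation (\<lambda>\<omega>. incr t k u \<omega> * incr t l v \<omega>) = expectation (\<lambda>\<omega>. a k * w k * (a l * w l) *
     (osc (w k) (clip t u) \<omega> * osc (w l) (clip t v) \<omega> - osc (w k) (clip t u) \<omega> * osc (w l) 0 \<omega>
      - osc (w k) 0 \<omega> * osc (w l) (clip t v) \<omega> + osc (w k) 0 \<omega> * osc (w l) 0 \<omega>))"
    by (rule Bochner_Integration.integral_cong) (auto simp: incr_def algebra_simps)
  also have "\<dots> = a k * w k * (a l * w l) * (exp (- (((w k)\<^sup>2 + (w l)\<^sup>2) / 2)) * (cosh (w k * w l * min (clip t u) (clip t v)) - 1))"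
  proof -
    have "expectation (\<lambda>\<omega>. osc (w k) (clip t u) \<omega> * osc (w l) (clip t v) \<omega> - osc (w k) (clip t u) \<omega> * osc (w l) 0 \<omega>
        - osc (w k) 0 \<omega> * osc (w l) (clip t v) \<omega> + osc (w k) 0 \<omega> * osc (w l) 0 \<omega>)
      = exp (- (((w k)\<^sup>2 + (w l)\<^sup>2) / 2)) * (cosh (w k * w l * min (clip t u) (clip t v)) - 1)"
      using cb assms by (simp add: int expectation_osc_mult right_diff_distrib)
    then show ?thesis
      by (simp only: integral_mult_right_zero)
  qed
  finally show ?thesis by (simp add: mult.assoc)
qed

lemma summable_w_osc:
  assumes "u < 1"
  shows "summable (\<lambda>k. a k * (w k * osc (w k) u \<omega>))"
proof (rule summable_comparison_test'[of "\<lambda>k. a k * (1 + 2 / (1 - u))" 0])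
  show "summable (\<lambda>k. a k * (1 + 2 / (1 - u)))"
    by (intro summable_mult2 a_summable)
  show "norm (a k * (w k * osc (w k) u \<omega>)) \<le> a k * (1 + 2 / (1 - u))" for k
    using a_nonneg[of k] abs_w_osc_le[of u u k \<omega>] assms
    unfolding real_norm_def abs_mult[of "a k"] by (simp add: mult_left_mono)
qed

text \<open>For \<open>u \<ge> 0\<close> and \<open>0 \<le> t < 1\<close> this is the increment from
  time 0 to time \<open>min u t\<close> of the gradient process.\<close>

definition total_incr :: "real \<Rightarrow> real \<Rightarrow> 'a \<Rightarrow> real" where
  "total_incr t u \<omega> = (\<Sum>k. incr t k u \<omega>)"

lemma summable_incr:
  assumes "0 \<le> t" "t < 1"
  shows "summable (\<lambda>k. incr t k u \<omega>)"
  unfolding incr_def using assms clip_bounds[of t u]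
  by (intro summable_diff summable_w_osc) auto

lemma abs_sum_incr_le:
  assumes "0 \<le> t" "t < 1"
  shows "\<bar>\<Sum>k<n. incr t k u \<omega>\<bar> \<le> suminf a * (2 * (1 + 2 / (1 - t)))"
proof -
  have "\<bar>\<Sum>k<n. incr t k u \<omega>\<bar> \<le> (\<Sum>k<n. a k * (2 * (1 + 2 / (1 - t))))"
    using abs_incr_le[OF assms] by (intro order_trans[OF sum_abs sum_mono]) auto
  also have "\<dots> = (\<Sum>k<n. a k) * (2 * (1 + 2 / (1 - t)))"
    by (simp add: sum_distrib_right)
  also have "\<dots> \<le> suminf a * (2 * (1 + 2 / (1 - t)))"
    using assms by (intro mult_right_mono sum_le_suminf a_summable a_nonneg) auto
  finally show ?thesis .
qed

lemma sum_incr_tendsto: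
  assumes "0 \<le> t" "t < 1"
  shows "(\<lambda>n. \<Sum>k<n. incr t k u \<omega>) \<longlonglongrightarrow> total_incr t u \<omega>"
  unfolding total_incr_def by (rule summable_LIMSEQ[OF summable_incr[OF assms]])

lemma abs_total_incr_le:
  assumes "0 \<le> t" "t < 1"
  shows "\<bar>total_incr t u \<omega>\<bar> \<le> suminf a * (2 * (1 + 2 / (1 - t)))"
  by (rule LIMSEQ_le_const2[OF tendsto_rabs[OF sum_incr_tendsto[OF assms]]])
    (use abs_sum_incr_le[OF assms] in blast)

lemma total_incr_measurable_pair:
  assumes "0 \<le> t" "t < 1"
  shows "(\<lambda>(\<omega>, u). total_incr t u \<omega>) \<in> borel_measurable (M \<Otimes>\<^sub>M borel)"
proof -
  have [measurable]: "(\<lambda>x. osc l (clip t (snd x)) (fst x)) \<in> borel_measurable (M \<Otimes>\<^sub>M borel)" for l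
    using osc_measurable_pair[of t l] assms by (simp add: case_prod_beta)
  have [measurable]: "osc l 0 \<in> borel_measurable M" for l
    by (rule osc_measurable) auto
  have "(\<lambda>x. \<Sum>k. incr t k (snd x) (fst x)) \<in> borel_measurable (M \<Otimes>\<^sub>M borel)"
    unfolding incr_def by measurable
  then show ?thesis
    by (simp add: case_prod_beta total_incr_def)
qed

lemma incr_measurable:
  assumes "0 \<le> t" "t < 1"
  shows "incr t k u \<in> borel_measurable M"
proof -
  have [measurable]: "osc l (clip t u) \<in> borel_measurable M" "osc l 0 \<in> borel_measurable M" for l
    using clip_bounds[of t u] assms by (auto intro!: osc_measurable)
  show ?thesis
    unfolding incr_def by measurable
qed

text \<open>All covariances of the increments are nonnegative, so the off-diagonal terms can be dropped.\<close>

lemma expectation_total_incr_mult_ge: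
  assumes t: "0 \<le> t" "t < 1" and s: "\<And>k. k < n \<Longrightarrow> 0 \<le> s k \<and> s k \<le> t"
  shows "(\<Sum>k<n. (a k * w k)\<^sup>2 * exp (- (w k)\<^sup>2) * (cosh ((w k)\<^sup>2 * s k) - 1) * (indicator {s k..} u * indicator {s k..} v))
    \<le> expectation (\<lambda>\<omega>. total_incr t u \<omega> * total_incr t v \<omega>)" (is "?L \<le> _")
proof (rule LIMSEQ_le_const)
  define B where "B = suminf a * (2 * (1 + 2 / (1 - t)))"
  note [measurable] = incr_measurable[OF t]
  have bnd: "\<bar>(\<Sum>k<m. incr t k u \<omega>) * (\<Sum>k<m. incr t k v \<omega>)\<bar> \<le> B * B" for m \<omega>
  proof -
    have "0 \<le> B" using abs_sum_incr_le[OF t, where n = 0 and u = u and \<omega> = \<omega>] by (simp add: B_def)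
    then show ?thesis
      unfolding abs_mult B_def using abs_sum_incr_le[OF t] by (intro mult_mono) auto
  qed
  \<comment> \<open>Partial sums are bounded uniformly in their length, so dominated convergence
    carries the estimate for finite sums to the full series.\<close>
  show "(\<lambda>m. expectation (\<lambda>\<omega>. (\<Sum>k<m. incr t k u \<omega>) * (\<Sum>k<m. incr t k v \<omega>)))
      \<longlonglongrightarrow> expectation (\<lambda>\<omega>. total_incr t u \<omega> * total_incr t v \<omega>)"
  proof (rule integral_dominated_convergence[where w = "\<lambda>_. B * B"])
    show "(\<lambda>\<omega>. total_incr t u \<omega> * total_incr t v \<omega>) \<in> borel_measurable M"
      unfolding total_incr_def by measurable
    show "AE \<omega> in M. (\<lambda>m. (\<Sum>k<m. incr t k u \<omega>) * (\<Sum>k<m. incr t k v \<omega>))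
        \<longlonglongrightarrow> total_incr t u \<omega> * total_incr t v \<omega>"
      by (intro AE_I2 tendsto_mult sum_incr_tendsto t)
    show "AE \<omega> in M. norm ((\<Sum>k<m. incr t k u \<omega>) * (\<Sum>k<m. incr t k v \<omega>)) \<le> B * B" for m
      using bnd by auto
  qed auto
  define m where "m = min (clip t u) (clip t v)"
  have m0: "0 \<le> m" using clip_bounds[OF t(1)] by (simp add: m_def)
  define G where "G k l = a k * w k * (a l * w l) * exp (- (((w k)\<^sup>2 + (w l)\<^sup>2) / 2)) * (cosh (w k * w l * m) - 1)" for k l
  have G0: "0 \<le> G k l" for k l
    unfolding G_def using a_nonneg w_nonneg cosh_real_ge_1[of "w k * w l * m"] by (intro mult_nonneg_nonneg) auto
  have "?L \<le> expectation (\<lambda>\<omega>. (\<Sum>k<N. incr t k u \<omega>) * (\<Sum>k<N. incr t k v \<omega>))" if N: "n \<le> N" for N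
  proof -
    have int: "integrable M (\<lambda>\<omega>. incr t k u \<omega> * incr t l v \<omega>)" for k l
    proof (rule integrable_if_abs_le)
      show "\<bar>incr t k u \<omega> * incr t l v \<omega>\<bar> \<le> (a k * (2 * (1 + 2 / (1 - t)))) * (a l * (2 * (1 + 2 / (1 - t))))" for \<omega>
        unfolding abs_mult[of "incr t k u \<omega>"] using a_nonneg t abs_incr_le[OF t] by (intro mult_mono) auto
    qed simp
    have "?L \<le> (\<Sum>k<n. G k k)"
    proof (rule sum_mono)
      fix k assume k: "k \<in> {..<n}"
      show "(a k * w k)\<^sup>2 * exp (- (w k)\<^sup>2) * (cosh ((w k)\<^sup>2 * s k) - 1) * (indicator {s k..} u * indicator {s k..} v) \<le> G k k"
      proof (cases "s k \<le> u \<and> s k \<le> v")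
        case True
        \<comment> \<open>Clipping at \<open>t\<close> does not push the times below
          \<open>s k\<close>, because \<open>s k \<le> t\<close>; monotonicity of
          \<open>cosh\<close> then gives the bound.\<close>
        then have "s k \<le> m" using s[of k] k by (auto simp: m_def clip_def)
        then have "cosh ((w k)\<^sup>2 * s k) \<le> cosh ((w k)\<^sup>2 * m)"
          using s[of k] k m0 by (subst cosh_real_nonneg_le_iff) (auto intro: mult_left_mono)
        then have "(a k * w k)\<^sup>2 * exp (- (w k)\<^sup>2) * (cosh ((w k)\<^sup>2 * s k) - 1) \<le> (a k * w k)\<^sup>2 * exp (- (w k)\<^sup>2) * (cosh ((w k)\<^sup>2 * m) - 1)"
          by (intro mult_left_mono) auto
        then show ?thesis
          using True by (simp add: G_def power2_eq_square)
      next
        case False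
        then show ?thesis using G0[of k k] by (auto simp: indicator_def)
      qed
    qed
    \<comment> \<open>First the diagonal terms from \<open>n\<close> on are added, then the
      off-diagonal ones, all nonnegative.\<close>
    also have "\<dots> \<le> (\<Sum>k<N. G k k)"
      using N G0 by (intro sum_mono2) auto
    also have "\<dots> \<le> (\<Sum>k<N. \<Sum>l<N. G k l)"
      using G0 by (intro sum_mono member_le_sum) auto
    also have "\<dots> = expectation (\<lambda>\<omega>. \<Sum>k<N. \<Sum>l<N. incr t k u \<omega> * incr t l v \<omega>)"
      by (simp add: int expectation_incr_mult[OF t] G_def m_def)
    finally show ?thesis by (simp add: sum_product)
  qed
  then show "\<exists>N. \<forall>m\<ge>N. ?L \<le> expectation (\<lambda>\<omega>. (\<Sum>k<m. incr t k u \<omega>) * (\<Sum>k<m. incr t k v \<omega>))"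
    by blast
qed

text \<open>The weight has total mass 1, so the initial value can be subtracted under the
  integral.\<close>

lemma frac_I_phi_sine_series:
  assumes \<alpha>: "0 < \<alpha>" and t: "0 \<le> t" "t < 1" and \<omega>: "\<omega> \<in> space M"
  shows "frac_I \<alpha> (phi M W sine_series) t \<omega> - phi M W sine_series 0 \<omega> = (\<integral>u. total_incr t u \<omega> \<partial>frac_kernel \<alpha>)"
proof -
  interpret R: prob_space "frac_kernel \<alpha>" by (rule prob_space_frac_kernel[OF \<alpha>])
  have meas[measurable]: "(\<lambda>u. total_incr t u \<omega>) \<in> borel_measurable borel"
    using measurable_Pair2[OF total_incr_measurable_pair[OF t] \<omega>] by simp
  let ?\<phi> = "phi M W sine_series"
  have eq: "?\<phi> (min u t) \<omega> = total_incr t u \<omega> + ?\<phi> 0 \<omega>" if "0 \<le> u" for u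
  proof -
    have c: "clip t u = min u t" using that t by (auto simp: clip_def)
    have m: "0 \<le> min u t" "min u t < 1" using that t by auto
    show ?thesis
      unfolding total_incr_def incr_def c phi_sine_series[OF m] phi_sine_series[OF order_refl zero_less_one]
      using summable_w_osc[OF m(2), of \<omega>] summable_w_osc[of 0 \<omega>] by (subst suminf_diff[symmetric]) auto
  qed
  have "frac_I \<alpha> ?\<phi> t \<omega> = (\<integral>u. \<alpha> * (indicator {0..1} u *\<^sub>R ((1 - u) powr (\<alpha> - 1) * ?\<phi> (min u t) \<omega>)) \<partial>lborel)"
    by (simp add: frac_I_def set_lebesgue_integral_def)
  also have "\<dots> = (\<integral>u. (indicator {0..1} u * (\<alpha> * (1 - u) powr (\<alpha> - 1))) *\<^sub>R (total_incr t u \<omega> + ?\<phi> 0 \<omega>) \<partial>lborel)"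
    by (intro Bochner_Integration.integral_cong) (auto simp: eq indicator_def)
  also have "\<dots> = (\<integral>u. total_incr t u \<omega> + ?\<phi> 0 \<omega> \<partial>frac_kernel \<alpha>)"
    unfolding frac_kernel_def using \<alpha> by (intro integral_density[symmetric]) auto
  also have "\<dots> = (\<integral>u. total_incr t u \<omega> \<partial>frac_kernel \<alpha>) + ?\<phi> 0 \<omega>"
  proof -
    have "integrable (frac_kernel \<alpha>) (\<lambda>u. total_incr t u \<omega>)"
      using abs_total_incr_le[OF t] by (intro R.integrable_const_bound[of _ "suminf a * (2 * (1 + 2 / (1 - t)))"]) auto
    then show ?thesis by (simp add: R.prob_space[simplified])
  qed
  finally show ?thesis by simp
qed

text \<open>The second moment is the double integral of the covariances against the kernel. In the
  lower bound for these, each product of indicators integrates to the square of the tail mass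
  \<open>(1 - s k) powr \<alpha>\<close>.\<close>

lemma expectation_frac_square_ge:
  assumes \<alpha>: "0 < \<alpha>" and t: "0 \<le> t" "t < 1" and s: "\<And>k. k < n \<Longrightarrow> 0 \<le> s k \<and> s k \<le> t"
  shows "(\<Sum>k<n. (a k * w k)\<^sup>2 * exp (- (w k)\<^sup>2) * (cosh ((w k)\<^sup>2 * s k) - 1) * (1 - s k) powr (2 * \<alpha>))
    \<le> expectation (\<lambda>\<omega>. (frac_I \<alpha> (phi M W sine_series) t \<omega> - phi M W sine_series 0 \<omega>)\<^sup>2)"
proof -
  interpret R: prob_space "frac_kernel \<alpha>" by (rule prob_space_frac_kernel[OF \<alpha>])
  define B where "B = suminf a * (2 * (1 + 2 / (1 - t)))"
  define H where "H u v = expectation (\<lambda>\<omega>. total_incr t u \<omega> * total_incr t v \<omega>)" for u v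
  define d where "d k = (a k * w k)\<^sup>2 * exp (- (w k)\<^sup>2) * (cosh ((w k)\<^sup>2 * s k) - 1)" for k
  note bnd = abs_total_incr_le[OF t, folded B_def]
  have B0: "0 \<le> B" using abs_ge_zero bnd order_trans by blast
  have pm: "(\<lambda>(\<omega>, u). total_incr t u \<omega>) \<in> borel_measurable (M \<Otimes>\<^sub>M frac_kernel \<alpha>)"
    using total_incr_measurable_pair[OF t] by (simp cong: measurable_cong_sets sets_pair_measure_cong)
  have [measurable]: "(\<lambda>x. total_incr t (snd x) (fst x)) \<in> borel_measurable (M \<Otimes>\<^sub>M borel)"
    using total_incr_measurable_pair[OF t] by (simp add: case_prod_beta)
  have XY[measurable]: "total_incr t u \<in> borel_measurable M" for u
    using measurable_Pair1[OF total_incr_measurable_pair[OF t], of u] by simp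
  \<comment> \<open>Joint measurability of the covariance comes from integrating out the sample
    point on the triple product.\<close>
  have Hm: "(\<lambda>x. H (fst x) (snd x)) \<in> borel_measurable (borel \<Otimes>\<^sub>M borel)"
  proof -
    have 1: "(\<lambda>z. total_incr t (fst (fst z)) (snd z)) \<in> borel_measurable ((borel \<Otimes>\<^sub>M borel) \<Otimes>\<^sub>M M)"
      by (rule measurable_compose[of "\<lambda>z. (snd z, fst (fst z))" _ "M \<Otimes>\<^sub>M borel" "\<lambda>x. total_incr t (snd x) (fst x)", simplified]) measurable
    have 2: "(\<lambda>z. total_incr t (snd (fst z)) (snd z)) \<in> borel_measurable ((borel \<Otimes>\<^sub>M borel) \<Otimes>\<^sub>M M)"
      by (rule measurable_compose[of "\<lambda>z. (snd z, snd (fst z))" _ "M \<Otimes>\<^sub>M borel" "\<lambda>x. total_incr t (snd x) (fst x)", simplified]) measurable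
    show ?thesis
      unfolding H_def
      by (rule borel_measurable_lebesgue_integral) (use borel_measurable_times[OF 1 2] in \<open>simp add: case_prod_beta\<close>)
  qed
  have Hb: "\<bar>H u v\<bar> \<le> B * B" for u v
  proof -
    have b: "\<bar>total_incr t u \<omega> * total_incr t v \<omega>\<bar> \<le> B * B" for \<omega>
      unfolding abs_mult using bnd B0 by (intro mult_mono) auto
    have "\<bar>H u v\<bar> \<le> expectation (\<lambda>\<omega>. \<bar>total_incr t u \<omega> * total_incr t v \<omega>\<bar>)"
      unfolding H_def by (rule integral_abs_bound)
    also have "\<dots> \<le> B * B"
      using b by (intro integral_le_const integrable_if_abs_le[of _ "B * B"]) auto
    finally show ?thesis .
  qed
  have Hu[measurable]: "H u \<in> borel_measurable borel" for u
    using measurable_Pair2[OF Hm, of u] by simp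
  have HI[measurable]: "(\<lambda>u. \<integral>v. H u v \<partial>frac_kernel \<alpha>) \<in> borel_measurable borel"
    by (rule R.borel_measurable_lebesgue_integral) (use Hm in \<open>simp add: case_prod_beta cong: measurable_cong_sets sets_pair_measure_cong\<close>)
  have iH: "integrable (frac_kernel \<alpha>) (H u)" for u
    using Hb by (intro R.integrable_const_bound[of _ "B * B"]) auto
  have iHI: "integrable (frac_kernel \<alpha>) (\<lambda>u. \<integral>v. H u v \<partial>frac_kernel \<alpha>)"
  proof (rule R.integrable_const_bound[of _ "B * B"])
    have "\<bar>\<integral>v. H u v \<partial>frac_kernel \<alpha>\<bar> \<le> B * B" for u
    proof -
      have "\<bar>\<integral>v. H u v \<partial>frac_kernel \<alpha>\<bar> \<le> (\<integral>v. \<bar>H u v\<bar> \<partial>frac_kernel \<alpha>)"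
        by (rule integral_abs_bound)
      also have "\<dots> \<le> B * B"
        using Hb by (intro R.integral_le_const integrable_abs iH) auto
      finally show ?thesis .
    qed
    then show "AE u in frac_kernel \<alpha>. norm (\<integral>v. H u v \<partial>frac_kernel \<alpha>) \<le> B * B" by auto
  qed simp
  have ii: "integrable (frac_kernel \<alpha>) (\<lambda>v. c * (e * indicator {r..} v) :: real)" for c e r
    by (intro R.integrable_const_bound[of _ "\<bar>c * e\<bar>"]) (auto simp: indicator_def)
  have ii': "integrable (frac_kernel \<alpha>) (indicator {r..} :: real \<Rightarrow> real)" for r
    using ii[of 1 1 r] by simp
  have inner: "(\<integral>v. (\<Sum>k<n. d k * (indicator {s k..} u * indicator {s k..} v)) \<partial>frac_kernel \<alpha>)
      = (\<Sum>k<n. d k * (measure (frac_kernel \<alpha>) {s k..} * indicator {s k..} u))" for u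
    by (subst Bochner_Integration.integral_sum) (auto simp: ii ii' mult.commute)
  have m: "(1 - s k) powr (2 * \<alpha>) = measure (frac_kernel \<alpha>) {s k..} * measure (frac_kernel \<alpha>) {s k..}" if "k < n" for k
    using s[OF that] t by (simp add: measure_frac_kernel[OF \<alpha>] powr_add[symmetric])
  have "(\<Sum>k<n. d k * (1 - s k) powr (2 * \<alpha>))
      = (\<integral>u. (\<integral>v. (\<Sum>k<n. d k * (indicator {s k..} u * indicator {s k..} v)) \<partial>frac_kernel \<alpha>) \<partial>frac_kernel \<alpha>)"
  proof -
    show ?thesis
      unfolding inner by (simp add: Bochner_Integration.integral_sum[OF ii] m)
  qed
  also have "\<dots> \<le> (\<integral>u. (\<integral>v. H u v \<partial>frac_kernel \<alpha>) \<partial>frac_kernel \<alpha>)"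
  proof (rule integral_mono[OF _ iHI])
    show "(\<integral>v. (\<Sum>k<n. d k * (indicator {s k..} u * indicator {s k..} v)) \<partial>frac_kernel \<alpha>) \<le> (\<integral>v. H u v \<partial>frac_kernel \<alpha>)" for u
    proof (rule integral_mono[OF _ iH])
      show "integrable (frac_kernel \<alpha>) (\<lambda>v. \<Sum>k<n. d k * (indicator {s k..} u * indicator {s k..} v))"
        by (intro Bochner_Integration.integrable_sum ii)
      show "(\<Sum>k<n. d k * (indicator {s k..} u * indicator {s k..} v)) \<le> H u v" for v
        unfolding d_def H_def by (rule expectation_total_incr_mult_ge[OF t s])
    qed
    show "integrable (frac_kernel \<alpha>) (\<lambda>u. \<integral>v. (\<Sum>k<n. d k * (indicator {s k..} u * indicator {s k..} v)) \<partial>frac_kernel \<alpha>)"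
      unfolding inner by (intro Bochner_Integration.integrable_sum ii)
  qed
  also have "\<dots> = expectation (\<lambda>\<omega>. (\<integral>u. total_incr t u \<omega> \<partial>frac_kernel \<alpha>)\<^sup>2)"
    unfolding H_def
    by (rule expectation_square_of_integral[symmetric, OF prob_space_axioms prob_space_frac_kernel[OF \<alpha>] pm bnd])
  also have "\<dots> = expectation (\<lambda>\<omega>. (frac_I \<alpha> (phi M W sine_series) t \<omega> - phi M W sine_series 0 \<omega>)\<^sup>2)"
    using frac_I_phi_sine_series[OF \<alpha> t] by (intro Bochner_Integration.integral_cong) auto
  finally show ?thesis by (simp add: d_def)
qed

end

subsection \<open>Second moments of BMO processes\<close>

context brownian
begin

lemma subalgebra_aug_filtration:
  assumes "t \<le> 1"
  shows "subalgebra M (aug_filtration M W t)"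
proof -
  let ?G = "{W s -` B \<inter> space M | s B. s \<in> {0..t} \<and> B \<in> sets borel} \<union> null_sets M"
  have G: "?G \<subseteq> sets M"
    using W_measurable assms by (auto intro!: measurable_sets[of _ M borel])
  then have "?G \<subseteq> Pow (space M)"
    using sets.sets_into_space by blast
  then show ?thesis
    unfolding subalgebra_def aug_filtration_def using sets.sigma_sets_subset[OF G] by auto
qed

text \<open>Right continuity reduces the supremum over time to a countable one, which makes it measurable.\<close>

lemma BMO2_imp_bounded_second_moment:
  assumes Y: "Y \<in> BMO2 M (aug_filtration M W)"
    and Y0: "\<And>\<omega>. \<omega> \<in> space M \<Longrightarrow> Y 0 \<omega> = 0"
  obtains C where "\<And>t. 0 \<le> t \<Longrightarrow> t < 1 \<Longrightarrow> expectation (\<lambda>\<omega>. (Y t \<omega>)\<^sup>2) \<le> C"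
proof -
  let ?F = "aug_filtration M W 0"
  interpret finite_measure_subalgebra M ?F
    by unfold_locales (rule subalgebra_aug_filtration, simp)
  have Ym[measurable]: "Y t \<in> borel_measurable M" if "0 \<le> t" "t < 1" for t
    using Y that unfolding BMO2_def
    by (auto intro!: measurable_from_subalg[OF subalgebra_aug_filtration[of t]])
  have rc: "((\<lambda>s. Y s \<omega>) \<longlongrightarrow> Y t \<omega>) (at_right t)" if "\<omega> \<in> space M" "0 \<le> t" "t < 1" for t \<omega>
    using Y that unfolding BMO2_def by (auto simp: continuous_within)
  define S where "S \<omega> = (SUP t\<in>{0..<1}. ennreal ((Y t \<omega> - left_val Y 0 \<omega>)\<^sup>2))" for \<omega>
  have S_eq: "S \<omega> = (SUP t\<in>{0..<1} \<inter> \<rat>. ennreal ((Y t \<omega>)\<^sup>2))" (is "_ = ?S \<omega>") if \<omega>: "\<omega> \<in> space M" for \<omega>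
  proof (rule antisym)
    have l: "left_val Y 0 \<omega> = 0" using Y0[OF \<omega>] by (simp add: left_val_def)
    show "?S \<omega> \<le> S \<omega>"
      unfolding S_def l by (rule SUP_subset_mono) auto
    show "S \<omega> \<le> ?S \<omega>"
      unfolding S_def l
    proof (rule SUP_least)
      fix t :: real assume t: "t \<in> {0..<1}"
      have "((\<lambda>s. ennreal ((Y s \<omega> - 0)\<^sup>2)) \<longlongrightarrow> ennreal ((Y t \<omega> - 0)\<^sup>2)) (at_right t)"
        using rc[OF \<omega>, of t] t by (intro tendsto_ennrealI tendsto_intros) auto
      show "ennreal ((Y t \<omega> - 0)\<^sup>2) \<le> ?S \<omega>"
      \<comment> \<open>If the value at \<open>t\<close> exceeded the rational supremum, so would
        all values slightly to the right of \<open>t\<close>, among them one at a rational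
        time.\<close>
      proof (rule ccontr)
        assume "\<not> ennreal ((Y t \<omega> - 0)\<^sup>2) \<le> ?S \<omega>"
        then have "\<forall>\<^sub>F s in at_right t. ?S \<omega> < ennreal ((Y s \<omega> - 0)\<^sup>2)"
          using \<open>((\<lambda>s. ennreal ((Y s \<omega> - 0)\<^sup>2)) \<longlongrightarrow> _) _\<close> by (auto simp: order_tendsto_iff)
        then obtain b where b: "b > t" "\<And>s. t < s \<Longrightarrow> s < b \<Longrightarrow> ?S \<omega> < ennreal ((Y s \<omega> - 0)\<^sup>2)"
          unfolding eventually_at_right_field by blast
        obtain r where r: "r \<in> \<rat>" "t < r" "r < min b 1"
          using Rats_dense_in_real[of t "min b 1"] b t by auto
        then have "ennreal ((Y r \<omega>)\<^sup>2) \<le> ?S \<omega>"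
          using t by (intro SUP_upper) auto
        with b(2)[of r] r show False by auto
      qed
    qed
  qed
  have S_meas: "S \<in> borel_measurable M"
  proof -
    have "?S \<in> borel_measurable M"
      by (intro borel_measurable_SUP countable_Int2 countable_rat measurable_compose[OF _ measurable_ennreal]
          borel_measurable_power Ym) auto
    then show ?thesis
      using S_eq by (subst measurable_cong) auto
  qed
  define N where "N = nn_cond_exp M ?F S"
  define b where "b = bmo2_norm M (aug_filtration M W) Y"
  have b: "b < \<top>" using Y by (simp add: BMO2_def b_def)
  \<comment> \<open>Of the supremum over starting times only \<open>a = 0\<close> is kept.\<close>
  have "esssup M (\<lambda>\<omega>. enn_sqrt (N \<omega>)) \<le> b"
    unfolding b_def bmo2_norm_def N_def S_def by (rule SUP_upper2[of 0]) auto
  then have "AE \<omega> in M. enn_sqrt (N \<omega>) \<le> b"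
    using esssup_AE[of "\<lambda>\<omega>. enn_sqrt (N \<omega>)" M] by (auto elim: eventually_mono)
  then have "AE \<omega> in M. N \<omega> \<le> ennreal ((enn2real b)\<^sup>2)"
  proof eventually_elim
    case (elim \<omega>)
    \<comment> \<open>\<open>enn_sqrt\<close> sends \<top> to \<top>, so a finite bound on the root
      forces a finite conditional expectation.\<close>
    then have "N \<omega> < \<top>" using b by (auto simp: enn_sqrt_def less_top[symmetric] top_unique split: if_splits)
    then obtain x where x: "N \<omega> = ennreal x" "0 \<le> x" by (cases "N \<omega>") auto
    obtain c where c: "b = ennreal c" "0 \<le> c" using b by (cases b) auto
    have "sqrt x \<le> c"
      using elim x c by (simp add: enn_sqrt_def)
    then have "x \<le> c\<^sup>2"
      using x by (simp add: sqrt_le_D)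
    then show ?case using x c by (simp add: ennreal_leI)
  qed
  then have "(\<integral>\<^sup>+\<omega>. N \<omega> \<partial>M) \<le> (\<integral>\<^sup>+\<omega>. ennreal ((enn2real b)\<^sup>2) \<partial>M)"
    by (rule nn_integral_mono_AE)
  also have "\<dots> = ennreal ((enn2real b)\<^sup>2)"
    by (simp add: emeasure_space_1)
  \<comment> \<open>Conditional expectation preserves the integral over the whole space.\<close>
  finally have "(\<integral>\<^sup>+\<omega>. S \<omega> \<partial>M) \<le> ennreal ((enn2real b)\<^sup>2)"
    using nn_cond_exp_intg[of "\<lambda>_. 1" S] S_meas by (simp add: N_def)
  then have "expectation (\<lambda>\<omega>. (Y t \<omega>)\<^sup>2) \<le> (enn2real b)\<^sup>2" if t: "0 \<le> t" "t < 1" for t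
  proof -
    have "(\<integral>\<^sup>+\<omega>. ennreal ((Y t \<omega>)\<^sup>2) \<partial>M) \<le> (\<integral>\<^sup>+\<omega>. S \<omega> \<partial>M)"
    proof (rule nn_integral_mono)
      fix \<omega> assume \<omega>: "\<omega> \<in> space M"
      then show "ennreal ((Y t \<omega>)\<^sup>2) \<le> S \<omega>"
        unfolding S_def using t Y0[OF \<omega>] by (intro SUP_upper2[of t]) (auto simp: left_val_def)
    qed
    also note \<open>(\<integral>\<^sup>+\<omega>. S \<omega> \<partial>M) \<le> ennreal ((enn2real b)\<^sup>2)\<close>
    finally have le: "(\<integral>\<^sup>+\<omega>. ennreal ((Y t \<omega>)\<^sup>2) \<partial>M) \<le> ennreal ((enn2real b)\<^sup>2)" .
    have "integrable M (\<lambda>\<omega>. (Y t \<omega>)\<^sup>2)"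
      using Y t by (simp add: BMO2_def)
    from nn_integral_eq_integral[OF this] le show ?thesis
      by simp
  qed
  then show ?thesis by (rule that)
qed

end

subsection \<open>Interpolation norm of the lacunary series\<close>

lemma sup_norm_le:
  assumes "\<And>x. \<bar>f x\<bar> \<le> B"
  shows "sup_norm f \<le> B"
  unfolding sup_norm_def using assms by (intro cSUP_least) auto

lemma sup_norm_nonneg:
  assumes "f \<in> Cb0"
  shows "0 \<le> sup_norm f"
proof -
  obtain B where "\<And>x. \<bar>f x\<bar> \<le> B"
    using assms by (auto simp: Cb0_def bounded_iff)
  then have "\<bar>f 0\<bar> \<le> sup_norm f"
    unfolding sup_norm_def by (intro cSUP_upper bdd_aboveI) auto
  then show ?thesis by linarith
qed

lemma lip_norm_le:
  assumes "\<And>x y. \<bar>f x - f y\<bar> \<le> B * \<bar>x - y\<bar>"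
  shows "lip_norm f \<le> B"
  unfolding lip_norm_def
proof (rule cSUP_least)
  show "{p :: real \<times> real. fst p \<noteq> snd p} \<noteq> {}"
    by (auto intro: exI[of _ 0] exI[of _ 1])
qed (use assms in \<open>auto simp: divide_simps\<close>)

lemma lip_norm_nonneg:
  assumes "f \<in> Lip0"
  shows "0 \<le> lip_norm f"
proof -
  obtain B where B: "\<And>x y. \<bar>f x - f y\<bar> \<le> B * \<bar>x - y\<bar>"
    using assms by (auto simp: Lip0_def lipschitz_on_def dist_real_def)
  have "\<bar>f 0 - f 1\<bar> / \<bar>0 - 1\<bar> \<le> lip_norm f"
    unfolding lip_norm_def
    by (rule cSUP_upper2[where x = "(0, 1)"]) (use B in \<open>auto simp: divide_simps intro!: bdd_aboveI[of _ B]\<close>)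
  then show ?thesis by simp
qed

text \<open>A real \<open>Inf\<close> lies below the members of a set only if the set is known to be
  bounded below; nonnegativity of both norms supplies the bound 0.\<close>

lemma K_fun_le:
  assumes "0 \<le> lam" "f0 \<in> Cb0" "f1 \<in> Lip0" "f = (\<lambda>x. f0 x + f1 x)"
  shows "K_fun lam f \<le> sup_norm f0 + lam * lip_norm f1"
  unfolding K_fun_def
proof (rule cInf_lower)
  show "bdd_below {sup_norm f0 + lam * lip_norm f1 |f0 f1. f0 \<in> Cb0 \<and> f1 \<in> Lip0 \<and> f = (\<lambda>x. f0 x + f1 x)}"
    using assms(1) by (intro bdd_belowI[of _ 0]) (auto simp: sup_norm_nonneg lip_norm_nonneg)
qed (use assms in auto)

lemma K_fun_nonneg:
  assumes "0 \<le> lam" "f0 \<in> Cb0" "f1 \<in> Lip0" "f = (\<lambda>x. f0 x + f1 x)"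
  shows "0 \<le> K_fun lam f"
  unfolding K_fun_def using assms
  by (intro cInf_greatest) (auto simp: sup_norm_nonneg lip_norm_nonneg)

lemma zero_in_Lip0: "(\<lambda>_. 0) \<in> Lip0"
  by (auto simp: Lip0_def intro!: exI[of _ 0] lipschitz_intros)

text \<open>The series is cut at \<open>n\<close>. The tail is small in sup-norm by the sum of its
  amplitudes, and the head is a trigonometric polynomial with Lipschitz constant at most the sum of
  amplitude times frequency.\<close>

lemma K_fun_sine_series_le:
  fixes a w :: "nat \<Rightarrow> real"
  assumes a: "\<And>k. 0 \<le> a k" "summable a" and w: "\<And>k. 0 \<le> w k" and lam: "0 \<le> lam"
  defines "f \<equiv> \<lambda>x. \<Sum>k. a k * sin (w k * x)"
  shows "f \<in> Cb0"
    and "K_fun lam f \<le> (\<Sum>k. a (k + n)) + lam * (\<Sum>k<n. a k * w k)"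
proof -
  have b: "\<bar>a k * sin (w k * x)\<bar> \<le> a k" for k x
    using a(1)[of k] by (simp add: abs_mult mult_left_le)
  have sm: "summable (\<lambda>k. a k * sin (w k * x))" for x
    by (rule summable_comparison_test'[OF a(2), of 0]) (use b in auto)
  have cont: "continuous_on UNIV f"
    unfolding f_def
  proof (rule uniform_limit_theorem)
    show "uniform_limit UNIV (\<lambda>n x. \<Sum>k<n. a k * sin (w k * x)) (\<lambda>x. \<Sum>k. a k * sin (w k * x)) sequentially"
      by (rule Weierstrass_m_test[OF _ a(2)]) (use b in auto)
    show "\<forall>\<^sub>F n in sequentially. continuous_on UNIV (\<lambda>x. \<Sum>k<n. a k * sin (w k * x))"
      by (intro always_eventually allI continuous_intros)
  qed simp
  define f0 where "f0 n x = f x - (\<Sum>k<n. a k * sin (w k * x))" for n x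
  define f1 where "f1 n x = (\<Sum>k<n. a k * sin (w k * x))" for n x
  have f0_le: "\<bar>f0 n x\<bar> \<le> (\<Sum>k. a (k + n))" for n x
  proof -
    have "f0 n x = (\<Sum>k. a (k + n) * sin (w (k + n) * x))"
      unfolding f0_def f_def by (rule suminf_minus_initial_segment[OF sm, symmetric])
    also have "\<bar>\<dots>\<bar> \<le> (\<Sum>k. a (k + n))"
      using norm_suminf_le[of "\<lambda>k. a (k + n) * sin (w (k + n) * x)" "\<lambda>k. a (k + n)"] b a(2)
      by (simp add: summable_iff_shift)
    finally show ?thesis .
  qed
  have f0: "f0 n \<in> Cb0" for n
    unfolding Cb0_def
  proof (intro CollectI conjI)
    show "continuous_on UNIV (f0 n)"
      unfolding f0_def by (intro continuous_intros cont)
    show "bounded (range (f0 n))"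
      using f0_le by (auto simp: bounded_iff)
    show "f0 n 0 = 0" by (simp add: f0_def f_def)
  qed
  \<comment> \<open>Cutting at 0 leaves the whole series as the tail.\<close>
  have "f0 0 = f" by (simp add: f0_def fun_eq_iff)
  with f0[of 0] show "f \<in> Cb0" by simp
  have f1_le: "\<bar>f1 n x - f1 n y\<bar> \<le> (\<Sum>k<n. a k * w k) * \<bar>x - y\<bar>" for x y
  proof -
    have s: "\<bar>sin u - sin v\<bar> \<le> \<bar>u - v\<bar>" for u v :: real
    proof -
      have "\<bar>sin u - sin v\<bar> = 2 * \<bar>sin ((u - v) / 2)\<bar> * \<bar>cos ((u + v) / 2)\<bar>"
        by (simp add: sin_diff_sin abs_mult)
      also have "\<dots> \<le> 2 * \<bar>(u - v) / 2\<bar> * 1"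
        using abs_sin_x_le_abs_x[of "(u - v) / 2"] by (intro mult_mono) auto
      finally show ?thesis by simp
    qed
    have "\<bar>f1 n x - f1 n y\<bar> \<le> (\<Sum>k<n. \<bar>a k * sin (w k * x) - a k * sin (w k * y)\<bar>)"
      unfolding f1_def sum_subtractf[symmetric] by (rule sum_abs)
    also have "\<dots> \<le> (\<Sum>k<n. a k * w k * \<bar>x - y\<bar>)"
    proof (rule sum_mono)
      fix k
      have "\<bar>sin (w k * x) - sin (w k * y)\<bar> \<le> w k * \<bar>x - y\<bar>"
        using s[of "w k * x" "w k * y"] w[of k] by (simp add: right_diff_distrib[symmetric] abs_mult)
      then show "\<bar>a k * sin (w k * x) - a k * sin (w k * y)\<bar> \<le> a k * w k * \<bar>x - y\<bar>"
        using a(1)[of k] by (simp add: right_diff_distrib[symmetric] abs_mult mult.assoc mult_left_mono)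
    qed
    finally show ?thesis by (simp add: sum_distrib_right)
  qed
  have f1: "f1 n \<in> Lip0"
    unfolding Lip0_def
  proof (intro CollectI conjI)
    show "\<exists>L. L-lipschitz_on UNIV (f1 n)"
      using f1_le a w by (intro exI[of _ "\<Sum>k<n. a k * w k"] lipschitz_onI) (auto simp: dist_real_def intro!: sum_nonneg)
  qed (simp add: f1_def)
  have "K_fun lam f \<le> sup_norm (f0 n) + lam * lip_norm (f1 n)"
    by (rule K_fun_le[OF lam f0 f1]) (simp add: f0_def f1_def)
  also have "\<dots> \<le> (\<Sum>k. a (k + n)) + lam * (\<Sum>k<n. a k * w k)"
    using lam by (intro add_mono mult_left_mono sup_norm_le lip_norm_le f0_le f1_le)
  finally show "K_fun lam f \<le> (\<Sum>k. a (k + n)) + lam * (\<Sum>k<n. a k * w k)" .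
qed

lemma ex_power_bracket:
  fixes L x :: real
  assumes "1 < L" "1 \<le> x"
  obtains m :: nat where "L ^ m \<le> x" "x < L ^ Suc m"
proof -
  define m where "m = (LEAST m. x < L ^ Suc m)"
  obtain i where "x < L ^ i" using real_arch_pow[OF assms(1)] by blast
  then have "x < L ^ Suc i" using assms by (meson less_le_trans lessI order_less_imp_le power_strict_increasing)
  then have m: "x < L ^ Suc m" unfolding m_def by (rule LeastI)
  have "L ^ m \<le> x"
  proof (cases m)
    case (Suc j)
    then have "\<not> x < L ^ Suc j" unfolding m_def by (intro not_less_Least) simp
    then show ?thesis using Suc by simp
  qed (use assms in simp)
  with m show ?thesis by (rule that[rotated])
qed

text \<open>Meant for integrands bounded by constants on geometric bands. Each band is enlarged to
  the interval from 0 to its right end, which costs only a constant factor; the two families serve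
  the bands accumulating at 0 and at infinity.\<close>

lemma nn_integral_interval_cover_finite:
  fixes g :: "real \<Rightarrow> ennreal"
  assumes "\<And>x. g x \<le> (\<Sum>n. ennreal (d n) * indicator {0..R n} x) + (\<Sum>n. ennreal (e n) * indicator {0..T n} x)"
    and "\<And>n. 0 \<le> d n" "\<And>n. 0 \<le> e n" "\<And>n. 0 \<le> R n" "\<And>n. 0 \<le> T n"
    and "summable (\<lambda>n. d n * R n)" "summable (\<lambda>n. e n * T n)"
  shows "(\<integral>\<^sup>+x. g x \<partial>lborel) < \<infinity>"
proof -
  have I: "(\<integral>\<^sup>+x. (\<Sum>n. ennreal (d n) * indicator {0..R n} x) \<partial>lborel) = (\<Sum>n. ennreal (d n * R n))"
    if "\<And>n. 0 \<le> d n" "\<And>n. 0 \<le> R n" for d R :: "nat \<Rightarrow> real"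
    using that by (subst nn_integral_suminf) (auto simp: nn_integral_cmult_indicator ennreal_mult)
  have "(\<integral>\<^sup>+x. g x \<partial>lborel) \<le> (\<integral>\<^sup>+x. (\<Sum>n. ennreal (d n) * indicator {0..R n} x)
      + (\<Sum>n. ennreal (e n) * indicator {0..T n} x) \<partial>lborel)"
    by (intro nn_integral_mono assms(1))
  also have "\<dots> = (\<Sum>n. ennreal (d n * R n)) + (\<Sum>n. ennreal (e n * T n))"
    using assms by (subst nn_integral_add) (auto simp: I)
  also have "\<dots> < \<infinity>"
    using assms by (auto simp: less_top[symmetric] ennreal_suminf_neq_top)
  finally show ?thesis .
qed

lemma suminf_ennreal_ge: "f (n::nat) \<le> (\<Sum>k. f k :: ennreal)"
  using sum_le_suminf[of f "{n}"] by simp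

section \<open>Amplitudes and frequencies of the lacunary series\<close>

locale lacunary =
  fixes \<theta> :: real
  assumes \<theta>: "0 < \<theta>" "\<theta> < 1"
begin

text \<open>The ratio is so large that both \<open>ratio powr \<theta>\<close> and \<open>ratio powr (1 - \<theta>)\<close> are at least 4, so
  that head and tail of the series are dominated by the terms next to the cut, in spite of the slowly
  varying coefficients.\<close>

definition ratio :: real where "ratio = 4 powr (1 / (\<theta> * (1 - \<theta>)))"
text \<open>Starting with exponent 1 keeps every squared frequency at least 16, which the divergence
  estimate uses.\<close>

definition freq :: "nat \<Rightarrow> real" where "freq k = ratio ^ Suc k"
text \<open>The borderline sequence: its powers with exponent above 2 are summable, while its
  squares form the harmonic series.\<close>

definition coef :: "nat \<Rightarrow> real" where "coef k = 1 / sqrt (real (Suc k))"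
definition amp :: "nat \<Rightarrow> real" where "amp k = coef k * freq k powr (- \<theta>)"

lemma ratio_powr: "4 \<le> ratio powr \<theta>" "4 \<le> ratio powr (1 - \<theta>)"
proof -
  have "ratio powr \<theta> = 4 powr (1 / (1 - \<theta>))" "ratio powr (1 - \<theta>) = 4 powr (1 / \<theta>)"
    using \<theta> by (simp_all add: ratio_def powr_powr)
  moreover have "4 \<le> (4::real) powr x" if "1 \<le> x" for x
    using powr_mono[OF that, of 4] by simp
  ultimately show "4 \<le> ratio powr \<theta>" "4 \<le> ratio powr (1 - \<theta>)"
    using \<theta> by auto
qed

lemma ratio_pos: "0 < ratio"
  by (simp add: ratio_def)

lemma ratio_ge: "4 \<le> ratio"
proof -
  have "4 * 1 \<le> ratio powr \<theta> * ratio powr (1 - \<theta>)"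
    using ratio_powr by (intro mult_mono) auto
  then show ?thesis
    using ratio_pos by (simp add: powr_add[symmetric])
qed

lemma freq_pos: "0 < freq k"
  using ratio_pos by (simp add: freq_def)

lemma coef_pos: "0 < coef k" and coef_le_1: "coef k \<le> 1"
  by (auto simp: coef_def divide_simps)

lemma coef_antimono: "coef (k + n) \<le> coef n"
  by (auto simp: coef_def intro!: divide_left_mono)

text \<open>The coefficients decay so slowly that one step costs at most a factor 2, which the
  geometric growth of the frequencies absorbs.\<close>

lemma coef_le_Suc: "coef n \<le> 2 * coef (Suc n)"
proof -
  have "sqrt (real (Suc (Suc n))) \<le> sqrt (4 * real (Suc n))" by simp
  also have "\<dots> = 2 * sqrt (real (Suc n))" by (simp add: real_sqrt_mult del: of_nat_Suc)
  finally show ?thesis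
    unfolding coef_def by (simp add: divide_simps del: of_nat_Suc)
qed

lemma amp_nonneg: "0 \<le> amp k"
  using coef_pos[of k] by (simp add: amp_def)

lemma freq_add_powr: "freq (k + n) powr x = (ratio powr x) ^ k * freq n powr x"
proof -
  have "freq (k + n) = ratio ^ k * freq n" by (simp add: freq_def power_add)
  moreover have "(ratio ^ k) powr x = (ratio powr x) ^ k"
    using ratio_pos by (simp add: powr_realpow[symmetric] powr_powr mult.commute)
  ultimately show ?thesis
    using ratio_pos freq_pos[of n] by (simp add: powr_mult)
qed

lemma amp_add_le: "amp (k + n) \<le> coef n * freq n powr (- \<theta>) * (1 / 4) ^ k"
proof -
  have r: "ratio powr (- \<theta>) \<le> 1 / 4"
    using ratio_powr(1) by (simp add: powr_minus_divide divide_simps)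
  have "amp (k + n) = coef (k + n) * ((ratio powr (- \<theta>)) ^ k * freq n powr (- \<theta>))"
    by (simp add: amp_def freq_add_powr)
  also have "\<dots> \<le> coef n * ((1 / 4) ^ k * freq n powr (- \<theta>))"
    using coef_pos[of n] r by (intro mult_mono coef_antimono power_mono) auto
  finally show ?thesis by (simp add: mult_ac)
qed

lemma amp_summable: "summable amp"
proof (rule summable_comparison_test'[of "\<lambda>k. coef 0 * freq 0 powr (- \<theta>) * (1 / 4) ^ k" 0])
  show "summable (\<lambda>k. coef 0 * freq 0 powr (- \<theta>) * (1 / 4) ^ k)"
    by (intro summable_mult summable_geometric) auto
  show "norm (amp k) \<le> coef 0 * freq 0 powr (- \<theta>) * (1 / 4) ^ k" for k
    using amp_add_le[of k 0] amp_nonneg[of k] by simp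
qed

lemma amp_tail_le: "(\<Sum>k. amp (k + n)) \<le> 2 * (coef n * freq n powr (- \<theta>))"
proof -
  have "(\<Sum>k. amp (k + n)) \<le> (\<Sum>k. coef n * freq n powr (- \<theta>) * (1 / 4) ^ k)"
    using amp_add_le amp_summable by (intro suminf_le summable_mult summable_geometric) (auto simp: summable_iff_shift)
  also have "\<dots> = coef n * freq n powr (- \<theta>) * (4 / 3)"
    by (simp add: suminf_mult suminf_geometric)
  also have "\<dots> \<le> 2 * (coef n * freq n powr (- \<theta>))"
    using coef_pos[of n] by simp
  finally show ?thesis .
qed

lemma amp_freq: "amp k * freq k = coef k * freq k powr (1 - \<theta>)"
  using freq_pos[of k] by (simp add: amp_def powr_diff powr_minus_divide)

text \<open>By induction the old sum and the new term are both at most the same quantity, a factor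
  2; moving to the next coefficient costs another 2. The product 4 is at most
  \<open>ratio powr (1 - \<theta>)\<close>.\<close>

lemma amp_head_le: "(\<Sum>k<n. amp k * freq k) \<le> coef n * freq n powr (1 - \<theta>)"
proof (induction n)
  case 0
  then show ?case using coef_pos[of 0] by simp
next
  case (Suc n)
  have "(\<Sum>k<Suc n. amp k * freq k) \<le> 2 * (coef n * freq n powr (1 - \<theta>))"
    using Suc amp_freq[of n] by simp
  also have "\<dots> \<le> 2 * ((2 * coef (Suc n)) * freq n powr (1 - \<theta>))"
    by (intro mult_left_mono mult_right_mono coef_le_Suc) auto
  also have "\<dots> = coef (Suc n) * (4 * freq n powr (1 - \<theta>))" by simp
  also have "\<dots> \<le> coef (Suc n) * (ratio powr (1 - \<theta>) * freq n powr (1 - \<theta>))"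
    using ratio_powr(2) coef_pos[of "Suc n"] by (intro mult_left_mono mult_right_mono) auto
  also have "\<dots> = coef (Suc n) * freq (Suc n) powr (1 - \<theta>)"
    using freq_add_powr[of 1 n] by simp
  finally show ?case .
qed

section \<open>The K-functional of the lacunary series\<close>

definition lac :: "real \<Rightarrow> real" where
  "lac x = (\<Sum>k. amp k * sin (freq k * x))"

lemma lac_in_Cb0: "lac \<in> Cb0"
  using K_fun_sine_series_le(1)[of amp freq 0] amp_nonneg amp_summable freq_pos
  unfolding lac_def by (simp add: less_imp_le)

lemma K_lac_nonneg: "0 \<le> lam \<Longrightarrow> 0 \<le> K_fun lam lac"
  by (rule K_fun_nonneg[OF _ lac_in_Cb0 zero_in_Lip0]) auto

lemma K_lac_le:
  assumes "0 \<le> lam"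
  shows "K_fun lam lac \<le> 2 * (coef n * freq n powr (- \<theta>)) + lam * (coef n * freq n powr (1 - \<theta>))"
proof -
  have "K_fun lam lac \<le> (\<Sum>k. amp (k + n)) + lam * (\<Sum>k<n. amp k * freq k)"
    using K_fun_sine_series_le(2)[of amp freq lam n] amp_nonneg amp_summable freq_pos assms
    unfolding lac_def by (simp add: less_imp_le)
  also have "\<dots> \<le> 2 * (coef n * freq n powr (- \<theta>)) + lam * (coef n * freq n powr (1 - \<theta>))"
    using assms by (intro add_mono mult_left_mono amp_tail_le amp_head_le)
  finally show ?thesis .
qed

text \<open>With the cut at \<open>n\<close> the bound scales: apart from \<open>coef n\<close> it
  depends only on \<open>x = lam * freq n\<close>, which stays between 1 and \<open>ratio\<close> on
  this band.\<close>

lemma K_lac_small: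
  assumes "0 < lam" "1 / ratio ^ Suc n < lam" "lam \<le> 1 / ratio ^ n"
  shows "lam powr (- \<theta>) * K_fun lam lac \<le> (2 + ratio) * coef n"
proof -
  define x where "x = lam * freq n"
  have x: "1 < x" "x \<le> ratio"
    using assms ratio_pos by (auto simp: x_def freq_def field_simps)
  have "lam powr (- \<theta>) * K_fun lam lac
      \<le> lam powr (- \<theta>) * (2 * (coef n * freq n powr (- \<theta>)) + lam * (coef n * freq n powr (1 - \<theta>)))"
    using assms by (intro mult_left_mono K_lac_le) auto
  also have "\<dots> = coef n * (2 * x powr (- \<theta>) + x powr (1 - \<theta>))"
    using assms freq_pos[of n] by (simp add: x_def powr_mult powr_diff powr_minus_divide field_simps)
  also have "\<dots> \<le> coef n * (2 * 1 + ratio)"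
  proof (intro mult_left_mono add_mono)
    show "x powr (- \<theta>) \<le> 1" using x \<theta> powr_mono[of "- \<theta>" 0 x] by simp
    have "x powr (1 - \<theta>) \<le> x" using x \<theta> powr_mono[of "1 - \<theta>" 1 x] by simp
    then show "x powr (1 - \<theta>) \<le> ratio" using x by simp
  qed (use coef_pos[of n] in auto)
  finally show ?thesis by (simp add: mult.commute)
qed

text \<open>For large \<open>lam\<close> the whole series is taken as the bounded part, so the
  K-functional is at most 2 and the decay comes from \<open>lam powr (- \<theta>)\<close>
  alone.\<close>

lemma K_lac_large:
  assumes "ratio ^ m \<le> lam"
  shows "lam powr (- \<theta>) * K_fun lam lac \<le> (2 + ratio) * (1 / 4) ^ m"
proof -
  have lam: "0 < lam" using assms ratio_pos by (meson less_le_trans zero_less_power)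
  have "K_fun lam lac \<le> (\<Sum>k. amp k)"
    using K_fun_sine_series_le(2)[of amp freq lam 0] amp_nonneg amp_summable freq_pos lam
    unfolding lac_def by (simp add: less_imp_le)
  also have "\<dots> \<le> 2 * (coef 0 * freq 0 powr (- \<theta>))"
    using amp_tail_le[of 0] by simp
  also have "\<dots> \<le> 2 * (1 * 1)"
  proof (intro mult_left_mono mult_mono coef_le_1)
    show "freq 0 powr (- \<theta>) \<le> 1"
      using ratio_ge \<theta> powr_mono[of "- \<theta>" 0 ratio] by (simp add: freq_def)
  qed auto
  finally have K: "K_fun lam lac \<le> 2" by simp
  have "lam powr (- \<theta>) \<le> (ratio ^ m) powr (- \<theta>)"
    using assms ratio_pos \<theta> by (intro powr_mono2') auto
  also have "\<dots> = (ratio powr (- \<theta>)) ^ m"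
    using ratio_pos by (simp add: powr_realpow[symmetric] powr_powr mult.commute)
  also have "\<dots> \<le> (1 / 4) ^ m"
    using ratio_powr(1) by (intro power_mono) (auto simp: powr_minus_divide divide_simps)
  finally have "lam powr (- \<theta>) * K_fun lam lac \<le> (1 / 4) ^ m * 2"
    using K K_lac_nonneg[of lam] lam by (intro mult_mono) auto
  also have "\<dots> \<le> (2 + ratio) * (1 / 4) ^ m"
    using ratio_pos by simp
  finally show ?thesis .
qed

lemma bracket:
  assumes "0 < lam"
  obtains (small) n where "1 / ratio ^ Suc n < lam" "lam \<le> 1 / ratio ^ n"
  | (large) m where "ratio ^ m \<le> lam" "lam < ratio ^ Suc m"
proof (cases "1 \<le> lam")
  case True
  have "1 < ratio" using ratio_ge by simp
  from ex_power_bracket[OF this True] show ?thesis using large by blast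
next
  case False
  have "1 < ratio" "1 \<le> 1 / lam" using ratio_ge False assms by auto
  from ex_power_bracket[OF this] obtain n where "ratio ^ n \<le> 1 / lam" "1 / lam < ratio ^ Suc n" .
  then show ?thesis using small[of n] assms ratio_pos by (simp add: field_simps)
qed

lemma summable_coef_powr:
  assumes "2 < r"
  shows "summable (\<lambda>n. coef n powr r)"
proof -
  have "coef n powr r = real (Suc n) powr (- (r / 2))" for n
  proof -
    have "coef n = real (Suc n) powr (- (1 / 2))"
      by (simp add: coef_def powr_minus_divide powr_half_sqrt)
    then show ?thesis by (simp add: powr_powr)
  qed
  moreover have "summable (\<lambda>n. real (Suc n) powr (- (r / 2)))"
    using assms by (subst summable_Suc_iff) (simp add: summable_real_powr_iff)
  ultimately show ?thesis by simp
qed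

text \<open>On each band the factor \<open>1 / lam\<close> and the right end of the band multiply to
  at most \<open>ratio\<close>. What remains is the sum of \<open>coef n powr r\<close> near 0,
  where \<open>r > 2\<close> is needed, and a geometric series near infinity.\<close>

lemma nn_integral_K_lac_finite:
  assumes r: "2 < r"
  shows "(\<integral>\<^sup>+ lam \<in> {0<..}. ennreal ((lam powr (-\<theta>) * K_fun lam lac) powr r / lam) \<partial>lborel) < \<infinity>"
proof (rule nn_integral_interval_cover_finite)
  let ?D = "2 + ratio"
  let ?d = "\<lambda>n. (?D * coef n) powr r * ratio ^ Suc n" and ?R = "\<lambda>n. 1 / ratio ^ n"
  let ?e = "\<lambda>m. (?D * (1 / 4) ^ m) powr r / ratio ^ m" and ?T = "\<lambda>m. ratio ^ Suc m"
  show "ennreal ((lam powr (-\<theta>) * K_fun lam lac) powr r / lam) * indicator {0<..} lam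
      \<le> (\<Sum>n. ennreal (?d n) * indicator {0..?R n} lam) + (\<Sum>m. ennreal (?e m) * indicator {0..?T m} lam)" for lam
  proof (cases "0 < lam")
    case True
    have K0: "0 \<le> lam powr (-\<theta>) * K_fun lam lac"
      using K_lac_nonneg[of lam] True by simp
    consider (small) n where "1 / ratio ^ Suc n < lam" "lam \<le> 1 / ratio ^ n"
      | (large) m where "ratio ^ m \<le> lam" "lam < ratio ^ Suc m"
      using bracket[OF True] by blast
    then show ?thesis
    proof cases
      case (small n)
      have "(lam powr (-\<theta>) * K_fun lam lac) powr r / lam \<le> (?D * coef n) powr r / (1 / ratio ^ Suc n)"
        using small K_lac_small[OF True small] K0 r True ratio_pos by (intro frac_le powr_mono2) auto
      then have "ennreal ((lam powr (-\<theta>) * K_fun lam lac) powr r / lam) \<le> ennreal (?d n) * indicator {0..?R n} lam"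
        using small True by (auto intro!: ennreal_leI)
      also have "\<dots> \<le> (\<Sum>n. ennreal (?d n) * indicator {0..?R n} lam)"
        by (rule suminf_ennreal_ge)
      finally show ?thesis using True by (simp add: add_increasing2)
    next
      case (large m)
      have "(lam powr (-\<theta>) * K_fun lam lac) powr r / lam \<le> (?D * (1 / 4) ^ m) powr r / ratio ^ m"
        using large K_lac_large[OF large(1)] K0 r True ratio_pos by (intro frac_le powr_mono2) auto
      then have "ennreal ((lam powr (-\<theta>) * K_fun lam lac) powr r / lam) \<le> ennreal (?e m) * indicator {0..?T m} lam"
        using large True by (auto intro!: ennreal_leI)
      also have "\<dots> \<le> (\<Sum>m. ennreal (?e m) * indicator {0..?T m} lam)"
        by (rule suminf_ennreal_ge)
      finally show ?thesis using True by (simp add: add_increasing)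
    qed
  qed simp
  show "summable (\<lambda>n. ?d n * ?R n)"
  proof -
    have "?d n * ?R n = ?D powr r * ratio * coef n powr r" for n
      using ratio_pos coef_pos[of n] by (simp add: powr_mult)
    then show ?thesis
      using summable_coef_powr[OF r] by (simp add: summable_mult)
  qed
  show "summable (\<lambda>n. ?e n * ?T n)"
  proof (rule summable_comparison_test'[of "\<lambda>n. ?D powr r * ratio * (1 / 4) ^ n" 0])
    show "summable (\<lambda>n. ?D powr r * ratio * (1 / 4) ^ n)"
      by (intro summable_mult summable_geometric) auto
    show "norm (?e n * ?T n) \<le> ?D powr r * ratio * (1 / 4) ^ n" for n
    proof -
      have p: "((1 / 4 :: real) ^ n) powr r \<le> (1 / 4) ^ n"
        using powr_mono'[of 1 r "(1 / 4 :: real) ^ n"] r by (simp add: power_le_one)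
      have "?e n * ?T n = ?D powr r * ratio * ((1 / 4) ^ n) powr r"
        using ratio_pos by (subst powr_mult) auto
      also have "\<dots> \<le> ?D powr r * ratio * (1 / 4) ^ n"
        using ratio_pos p by (intro mult_left_mono) auto
      finally show ?thesis using ratio_pos by simp
    qed
  qed
qed (use ratio_pos coef_pos in \<open>auto simp: less_imp_le\<close>)

lemma lac_in_interp_space:
  assumes "2 < q"
  shows "lac \<in> interp_space \<theta> q"
proof -
  have "\<exists>f0 f1. f0 \<in> Cb0 \<and> f1 \<in> Lip0 \<and> lac = (\<lambda>x. f0 x + f1 x)"
    using lac_in_Cb0 zero_in_Lip0 by (intro exI[of _ lac] exI[of _ "\<lambda>_. 0"]) auto
  moreover have "bdd_above ((\<lambda>lam. lam powr (-\<theta>) * K_fun lam lac) ` {0<..})"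
  proof (rule bdd_aboveI2)
    fix lam :: real assume "lam \<in> {0<..}"
    then have lam: "0 < lam" by simp
    consider (small) n where "1 / ratio ^ Suc n < lam" "lam \<le> 1 / ratio ^ n"
      | (large) m where "ratio ^ m \<le> lam" "lam < ratio ^ Suc m"
      using bracket[OF lam] by blast
    then show "lam powr (-\<theta>) * K_fun lam lac \<le> 2 + ratio"
    proof cases
      case (small n)
      have "(2 + ratio) * coef n \<le> 2 + ratio"
        using ratio_pos coef_le_1[of n] by (intro mult_left_le) auto
      then show ?thesis
        using K_lac_small[OF lam small] by linarith
    next
      case (large m)
      have "(2 + ratio) * (1 / 4) ^ m \<le> 2 + ratio"
        using ratio_pos by (intro mult_left_le) (auto simp: power_le_one)
      then show ?thesis
        using K_lac_large[OF large(1)] by linarith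
    qed
  qed
  moreover have "2 < real_of_ereal q" if "q \<noteq> \<infinity>"
    using assms that by (cases q) auto
  ultimately show ?thesis
    unfolding interp_space_def using nn_integral_K_lac_finite by auto
qed

end

subsection \<open>Divergence of the second moment\<close>

text \<open>The main term \<open>exp (- 1) / 2\<close> is at least 1/6, and the subtracted
  \<open>exp (- y)\<close> is at most 1/17.\<close>

lemma exp_mult_cosh_ge:
  fixes y :: real
  assumes "16 \<le> y"
  shows "1 / 12 \<le> exp (- y) * (cosh (y - 1) - 1)"
proof -
  have "1 / 3 \<le> exp (- 1 :: real)"
    using exp_le by (simp add: exp_minus divide_simps)
  moreover have "exp (- y) \<le> 1 / 17"
  proof -
    have "17 \<le> exp y" using exp_ge_add_one_self[of y] assms by linarith
    then show ?thesis by (simp add: exp_minus divide_simps)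
  qed
  moreover have "exp (- y) * (cosh (y - 1) - 1) = exp (- 1) / 2 + exp (1 - 2 * y) / 2 - exp (- y)"
    by (simp add: cosh_def right_diff_distrib distrib_left exp_add[symmetric])
  moreover have "0 < exp (1 - 2 * y)" by simp
  ultimately show ?thesis by linarith
qed

theorem theorem5p1:
  fixes M :: "'a measure" and W :: "real \<Rightarrow> 'a \<Rightarrow> real"
    and \<theta> :: real and q :: ereal
  assumes "brownian_setting M W"
    and "0 < \<theta>" and "\<theta> < 1" and "2 < q"
  shows "\<exists>f \<in> interp_space \<theta> q.
           (\<lambda>t \<omega>. frac_I ((1 - \<theta>) / 2) (phi M W f) t \<omega> - phi M W f 0 \<omega>)
             \<notin> BMO2 M (aug_filtration M W)"
proof -
  interpret lacunary \<theta> by unfold_locales fact+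
  interpret brownian_series M W amp freq
    using assms(1) amp_nonneg amp_summable freq_pos by unfold_locales (auto simp: less_imp_le)
  have lac_eq: "lac = sine_series"
    by (simp add: fun_eq_iff lac_def sine_series_def)
  define \<alpha> where "\<alpha> = (1 - \<theta>) / 2"
  have \<alpha>: "0 < \<alpha>" using assms by (simp add: \<alpha>_def)
  define Y where "Y t \<omega> = frac_I \<alpha> (phi M W sine_series) t \<omega> - phi M W sine_series 0 \<omega>" for t \<omega>
  have "Y \<notin> BMO2 M (aug_filtration M W)"
  proof
    assume Y: "Y \<in> BMO2 M (aug_filtration M W)"
    \<comment> \<open>At \<open>t = 0\<close> every clipped time is 0, so all increments
      vanish.\<close>
    have "Y 0 \<omega> = 0" if "\<omega> \<in> space M" for \<omega>
      using frac_I_phi_sine_series[OF \<alpha> _ _ that, of 0]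
      by (simp add: Y_def total_incr_def incr_def clip_def)
    from BMO2_imp_bounded_second_moment[OF Y this] obtain C
      where C: "\<And>t. 0 \<le> t \<Longrightarrow> t < 1 \<Longrightarrow> expectation (\<lambda>\<omega>. (Y t \<omega>)\<^sup>2) \<le> C"
      by blast
    \<comment> \<open>At distance \<open>1 / (freq k)^2\<close> from the terminal time the damping
      exponent of the \<open>k\<close>-th mode equals 1/2, so from there on the mode has essentially
      its full size.\<close>
    define s where "s k = 1 - 1 / (freq k)\<^sup>2" for k
    have fsq: "16 \<le> (freq k)\<^sup>2" for k
    proof -
      have "ratio ^ 1 \<le> freq k"
        unfolding freq_def using ratio_ge by (intro power_increasing) auto
      then have "4 \<le> freq k" using ratio_ge by simp
      then have "4\<^sup>2 \<le> (freq k)\<^sup>2" by (intro power_mono) auto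
      then show ?thesis by simp
    qed
    have s01: "0 \<le> s k" "s k < 1" for k
      using fsq[of k] by (auto simp: s_def divide_simps)
    have s_mono: "s k \<le> s n" if "k < n" for k n
    proof -
      have "freq k \<le> freq n"
        unfolding freq_def using that ratio_ge by (intro power_increasing) auto
      then have "(freq k)\<^sup>2 \<le> (freq n)\<^sup>2"
        using freq_pos[of k] by (intro power_mono) auto
      then show ?thesis
        using fsq[of k] by (auto simp: s_def intro!: frac_le)
    qed
    have summand: "1 / 12 * (1 / real (Suc k))
      \<le> (amp k * freq k)\<^sup>2 * exp (- (freq k)\<^sup>2) * (cosh ((freq k)\<^sup>2 * s k) - 1) * (1 - s k) powr (2 * \<alpha>)" for k
    proof -
      have "(freq k)\<^sup>2 * s k = (freq k)\<^sup>2 - 1"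
        using freq_pos[of k] by (simp add: s_def field_simps)
      then have 1: "1 / 12 \<le> exp (- (freq k)\<^sup>2) * (cosh ((freq k)\<^sup>2 * s k) - 1)"
        using exp_mult_cosh_ge[OF fsq[of k]] by simp
      \<comment> \<open>This value of \<alpha> is critical: the squared tail mass cancels the growth
        of \<open>(amp k * freq k)^2\<close> exactly and leaves \<open>(coef k)^2\<close>.\<close>
      have "2 * \<alpha> = 1 - \<theta>" by (simp add: \<alpha>_def)
      then have "(1 - s k) powr (2 * \<alpha>) = 1 / (freq k powr (1 - \<theta>))\<^sup>2"
        using freq_pos[of k] by (simp add: s_def powr_divide power2_eq_square powr_mult)
      then have 2: "(amp k * freq k)\<^sup>2 * (1 - s k) powr (2 * \<alpha>) = 1 / real (Suc k)"
        using freq_pos[of k] by (simp add: amp_freq power_mult_distrib coef_def power_divide)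
      have "1 / 12 * ((amp k * freq k)\<^sup>2 * (1 - s k) powr (2 * \<alpha>))
        \<le> exp (- (freq k)\<^sup>2) * (cosh ((freq k)\<^sup>2 * s k) - 1) * ((amp k * freq k)\<^sup>2 * (1 - s k) powr (2 * \<alpha>))"
        using 1 by (intro mult_right_mono) auto
      then show ?thesis
        unfolding 2 by (subst (asm) 2[symmetric]) (simp add: mult_ac)
    qed
    have bound: "(\<Sum>k\<le>n. 1 / real (Suc k)) \<le> 12 * C" for n
    proof -
      have "(\<Sum>k\<le>n. 1 / 12 * (1 / real (Suc k))) \<le> (\<Sum>k<Suc n. (amp k * freq k)\<^sup>2 * exp (- (freq k)\<^sup>2)
          * (cosh ((freq k)\<^sup>2 * s k) - 1) * (1 - s k) powr (2 * \<alpha>))"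
        unfolding lessThan_Suc_atMost by (intro sum_mono summand)
      \<comment> \<open>The time \<open>s (Suc n)\<close> is below 1 and not before any
        \<open>s k\<close> with \<open>k \<le> n\<close>, so one time serves all terms while
        \<open>C\<close> does not depend on it.\<close>
      also have "\<dots> \<le> expectation (\<lambda>\<omega>. (Y (s (Suc n)) \<omega>)\<^sup>2)"
        unfolding Y_def using s01 s_mono by (intro expectation_frac_square_ge \<alpha>) auto
      also have "\<dots> \<le> C"
        by (intro C s01)
      finally show ?thesis
        unfolding sum_distrib_left[symmetric] by linarith
    qed
    have "summable (\<lambda>k. 1 / real (Suc k))"
      by (rule bounded_imp_summable[OF _ bound]) auto
    then have "summable (\<lambda>k. inverse (real k))"
      by (subst (asm) summable_Suc_iff) (simp add: inverse_eq_divide)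
    then show False
      using not_summable_harmonic[where 'a = real] by simp
  qed
  then show ?thesis
    using lac_in_interp_space[OF assms(4)] unfolding lac_eq Y_def \<alpha>_def by blast
qed

end
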